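(* The $2$-functor $\tilde D:\mathsf{OPCA}_D\to\mathsf{ArrAlg}$, given by $\mathbb A\mapsto D\mathbb A$ and $f\mapsto\tilde f$ with $\tilde f(\alpha)=\bigcup_{a\in\alpha}f(a)$, restricts to a $2$-fully faithful $2$-functor $\mathsf{OPCA}_{D,\mathsf{cd}}\hookrightarrow\mathsf{ArrAlg}_{\mathsf{cd}}$. Explicitly, for all PCAs $\mathbb A$ and $\mathbb B$, $\tilde D$ realizes an equivalence of preorder categories $$\mathsf{OPCA}_{D,\mathsf{cd}}(\mathbb A,\mathbb B)\simeq\mathsf{ArrAlg}_{\mathsf{cd}}(D\mathbb A,D\mathbb B).$$
   Context: An arrow algebra $\mathcal A=(A,\preccurlyeq,\to,S)$ consists of a poset $(A,\preccurlyeq)$ with all meets $\bigwedge$; a binary operation $\to$ on $A$ (bracketed to the right), antitone in the first and monotone in the second argument; and a subset $S\subseteq A$ (the separator) which is upward closed, closed under modus ponens ($a\to b\in S$ and $a\in S$ imply $b\in S$), and contains the combinators $\mathbf k=\bigwedge_{a,b}a\to b\to a$, $\mathbf s=\bigwedge_{a,b,c}(a\to b\to c)\to(a\to b)\to a\to c$, and $\mathbf a=\bigwedge_{a,(b_i)_{i\in I},(c_i)_{i\in I}}\big(\bigwedge_{i\in I}a\to b_i\to c_i\big)\to a\to\bigwedge_{i\in I}(b_i\to c_i)$. An implicative morphism $f:\mathcal A\to\mathcal B$ is a function $f:A\to B$ such that: (i) $f(a)\in S_B$ for every $a\in S_A$; (ii) there is $r\in S_B$ with $r\preccurlyeq f(a\to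 a')\to f(a)\to f(a')$ for all $a,a'\in A$; (iii) for every $X\subseteq A\times A$, if $\bigwedge_{(a,a')\in X}a\to a'\in S_A$ then $\bigwedge_{(a,a')\in X}f(a)\to f(a')\in S_B$. Write $f\vdash f'$ if $\bigwedge_{a\in A}f(a)\to f'(a)\in S_B$. $\mathsf{ArrAlg}$ is the resulting preorder-enriched category. An implicative morphism $f:\mathcal A\to\mathcal B$ is computationally dense if there is an implicative morphism $h:\mathcal B\to\mathcal A$ with $fh\vdash\mathrm{id}_B$ and $\mathrm{id}_A\vdash hf$; $\mathsf{ArrAlg}_{\mathsf{cd}}$ is the wide subcategory on these. PCA means filtered ordered partial combinatory algebra $\mathbb P=(P,\leq,\cdot,P^\#)$: a poset $(P,\le)$ with a partial binary application such that if $a\le a'$, $b\le b'$ and $a'b'$ is defined then $ab$ is defined and $ab\le a'b'$; a filter $P^\#\subseteq P$, i.e. an upward closed subset closed under defined application; and elements $\mathbf k,\mathbf s\in P^\#$ such that $\mathbf kab$ is defined and $\le a$; $\mathbf sab$ is defined; and if $ac(bc)$ is defined then $\mathbf sabc$ is defined and $\le ac(bc)$. Write $e\downarrow$ for "$e$ is defined". A morphism of PCAs $\mathbb A\to\mathbb B$ is a function $f:A\to B$ with: $f(a)\in B^\#$ for $a\in A^\#$; there is $t\in B^\#$ such that if $aa'\downarrow$ then $tf(a)f(a')\downarrow$ and $tf(a)f(a')\le f(aa')$; there is $u\in B^\#$ such that if $a\le a'$ then $uf(a)\downarrow$ and $uf(a)\le f(a')$. Put $f\le f'$ if there is $s\in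 B^\#$ with $sf(a)\downarrow$ and $sf(a)\le f'(a)$ for all $a\in A$. This gives the preorder-enriched category $\mathsf{OPCA}$. For a PCA $\mathbb P$, $DP$ is the set of downward closed subsets of $P$ ordered by inclusion, with application $\alpha\cdot\beta=\{z: z\le xy \text{ for some } x\in\alpha,y\in\beta\}$, defined iff $xy\downarrow$ for all $x\in\alpha,y\in\beta$, and filter $(DP)^\#=\{\alpha\in DP:\alpha\cap P^\#\ne\emptyset\}$; this is a PCA $D\mathbb P$. It is also regarded as an arrow algebra $D\mathbb P=(DP,\subseteq,\to,(DP)^\#)$ with $\alpha\to\beta=\{a\in P: ax\downarrow\text{ and }ax\in\beta\text{ for all }x\in\alpha\}$. $\mathsf{OPCA}_D$ is the Kleisli (preorder-enriched) bicategory of the pseudomonad $D$ on $\mathsf{OPCA}$: objects are PCAs; morphisms $\mathbb A\to\mathbb B$, called partial applicative morphisms, are morphisms of PCAs $f:\mathbb A\to D\mathbb B$, ordered as in $\mathsf{OPCA}(\mathbb A,D\mathbb B)$; the composite of $f:\mathbb A\to\mathbb B$ and $g:\mathbb B\to\mathbb C$ is $a\mapsto\bigcup_{b\in f(a)}g(b)$; the identity is $a\mapsto\{x:x\le a\}$. A partial applicative morphism $f:\mathbb A\to\mathbb B$ is computationally dense if there is $m\in B^\#$ such that for every $s\in B^\#$ there is $r\in A^\#$ such that, for every $a\in A$ with $sf(a)\downarrow$, $mf(ra)\downarrow$ and $mf(ra)\subseteq sf(a)$; here, for $b\in B$ and $\beta\in DB$, $b\beta=\{z:z\le bx\text{ for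 some }x\in\beta\}$, defined iff $bx\downarrow$ for all $x\in\beta$ (and $mf(ra)\downarrow$ includes $ra\downarrow$). $\mathsf{OPCA}_{D,\mathsf{cd}}$ is the wide sub-bicategory of $\mathsf{OPCA}_D$ on computationally dense partial applicative morphisms. A $2$-functor is $2$-fully faithful if it induces equivalences of preorders on hom-preorders. *)

theory Defs
  imports "HOL-Algebra.Complete_Lattice" "HOL-Library.FuncSet"
begin

text \<open>
  Posets are the carrier-based partial orders of HOL-Algebra. Maps between carriers are extensional
  (\<open>undefined\<close> outside their domain), so that a hom-set is literally a set of functions between
  carriers and functoriality can be stated with equality.
\<close>

record 'a arrow_algebra = "'a gorder" +
  arr :: "'a \<Rightarrow> 'a \<Rightarrow> 'a" (infixr \<open>\<leadsto>\<index>\<close> 60)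
  sep :: "'a set"

text \<open>
  In \<open>sep_a\<close>, the relation \<open>R\<close> is the range of a family \<open>(b\<^sub>i, c\<^sub>i)\<close> indexed by
  an arbitrary, possibly empty, set; both meets depend on the family only through its range.
\<close>

locale arrow_algebra = partial_order A for A (structure) +
  assumes inf_exists: "X \<subseteq> carrier A \<Longrightarrow> \<exists>i. greatest A i (Lower A X)"
    and arr_closed: "\<lbrakk>a \<in> carrier A; b \<in> carrier A\<rbrakk> \<Longrightarrow> a \<leadsto> b \<in> carrier A"
    and arr_mono:
      "\<lbrakk>a \<in> carrier A; a' \<in> carrier A; b \<in> carrier A; b' \<in> carrier A; a' \<sqsubseteq> a; b \<sqsubseteq> b'\<rbrakk>
        \<Longrightarrow> a \<leadsto> b \<sqsubseteq> a' \<leadsto> b'"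
    and sep_subset: "sep A \<subseteq> carrier A"
    and sep_upward: "\<lbrakk>a \<in> sep A; b \<in> carrier A; a \<sqsubseteq> b\<rbrakk> \<Longrightarrow> b \<in> sep A"
    and sep_mp: "\<lbrakk>a \<in> carrier A; b \<in> carrier A; a \<leadsto> b \<in> sep A; a \<in> sep A\<rbrakk> \<Longrightarrow> b \<in> sep A"
    and sep_k: "\<Sqinter>{a \<leadsto> b \<leadsto> a | a b. a \<in> carrier A \<and> b \<in> carrier A} \<in> sep A"
    and sep_s:
      "\<Sqinter>{(a \<leadsto> b \<leadsto> c) \<leadsto> (a \<leadsto> b) \<leadsto> a \<leadsto> c | a b c.
          a \<in> carrier A \<and> b \<in> carrier A \<and> c \<in> carrier A} \<in> sep A"
    and sep_a:
      "\<Sqinter>{\<Sqinter>{a \<leadsto> b \<leadsto> c | b c. (b, c) \<in> R} \<leadsto> a \<leadsto> \<Sqinter>{b \<leadsto> c | b c. (b, c) \<in> R} | a R.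
          a \<in> carrier A \<and> R \<subseteq> carrier A \<times> carrier A} \<in> sep A"

definition ArrAlg ::
  "('a, 'm) arrow_algebra_scheme \<Rightarrow> ('b, 'n) arrow_algebra_scheme \<Rightarrow> ('a \<Rightarrow> 'b) set" where
  "ArrAlg A B = {f \<in> carrier A \<rightarrow>\<^sub>E carrier B.
     (\<forall>a \<in> sep A. f a \<in> sep B) \<and>
     (\<exists>r \<in> sep B. \<forall>a \<in> carrier A. \<forall>a' \<in> carrier A.
        r \<sqsubseteq>\<^bsub>B\<^esub> f (a \<leadsto>\<^bsub>A\<^esub> a') \<leadsto>\<^bsub>B\<^esub> f a \<leadsto>\<^bsub>B\<^esub> f a') \<and>
     (\<forall>X \<subseteq> carrier A \<times> carrier A.
        \<Sqinter>\<^bsub>A\<^esub>{a \<leadsto>\<^bsub>A\<^esub> a' | a a'. (a, a') \<in> X} \<in> sep A \<longrightarrow>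
        \<Sqinter>\<^bsub>B\<^esub>{f a \<leadsto>\<^bsub>B\<^esub> f a' | a a'. (a, a') \<in> X} \<in> sep B)}"

definition ArrAlg_le ::
  "('a, 'm) arrow_algebra_scheme \<Rightarrow> ('b, 'n) arrow_algebra_scheme \<Rightarrow> ('a \<Rightarrow> 'b) \<Rightarrow> ('a \<Rightarrow> 'b) \<Rightarrow> bool"
  where "ArrAlg_le A B f f' \<longleftrightarrow> \<Sqinter>\<^bsub>B\<^esub>{f a \<leadsto>\<^bsub>B\<^esub> f' a | a. a \<in> carrier A} \<in> sep B"

definition ArrAlg_id :: "('a, 'm) arrow_algebra_scheme \<Rightarrow> 'a \<Rightarrow> 'a" where
  "ArrAlg_id A = (\<lambda>a \<in> carrier A. a)"

definition ArrAlg_comp ::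
  "('a, 'm) arrow_algebra_scheme \<Rightarrow> ('b \<Rightarrow> 'c) \<Rightarrow> ('a \<Rightarrow> 'b) \<Rightarrow> ('a \<Rightarrow> 'c)" where
  "ArrAlg_comp A g f = (\<lambda>a \<in> carrier A. g (f a))"

definition ArrAlg_cd ::
  "('a, 'm) arrow_algebra_scheme \<Rightarrow> ('b, 'n) arrow_algebra_scheme \<Rightarrow> ('a \<Rightarrow> 'b) set" where
  "ArrAlg_cd A B = {f \<in> ArrAlg A B. \<exists>h \<in> ArrAlg B A.
     ArrAlg_le B B (ArrAlg_comp B f h) (ArrAlg_id B) \<and>
     ArrAlg_le A A (ArrAlg_id A) (ArrAlg_comp A h f)}"

record 'a pca = "'a gorder" +
  app :: "'a \<Rightarrow> 'a \<Rightarrow> 'a option"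
  filt :: "'a set"

text \<open>
  Possibly undefined expressions are of type \<open>'a option\<close>; an application is defined iff both
  arguments are and the application of their values is.
\<close>

definition papp :: "('a, 'm) pca_scheme \<Rightarrow> 'a option \<Rightarrow> 'a option \<Rightarrow> 'a option"
    (infixl \<open>\<bullet>\<index>\<close> 70) where
  "x \<bullet>\<^bsub>P\<^esub> y = Option.bind x (\<lambda>a. Option.bind y (\<lambda>b. app P a b))"

text \<open>The expression \<open>e\<close> is defined and its value is below \<open>a\<close>.\<close>

definition def_le :: "('a, 'm) gorder_scheme \<Rightarrow> 'a option \<Rightarrow> 'a \<Rightarrow> bool" where
  "def_le P e a \<longleftrightarrow> (\<exists>v. e = Some v \<and> v \<sqsubseteq>\<^bsub>P\<^esub> a)"

locale pca = partial_order P for P (structure) +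
  assumes app_closed: "\<lbrakk>a \<in> carrier P; b \<in> carrier P; app P a b = Some c\<rbrakk> \<Longrightarrow> c \<in> carrier P"
    and app_mono:
      "\<lbrakk>a \<in> carrier P; a' \<in> carrier P; b \<in> carrier P; b' \<in> carrier P;
        a \<sqsubseteq> a'; b \<sqsubseteq> b'; app P a' b' = Some c'\<rbrakk> \<Longrightarrow> def_le P (app P a b) c'"
    and filt_subset: "filt P \<subseteq> carrier P"
    and filt_upward: "\<lbrakk>a \<in> filt P; b \<in> carrier P; a \<sqsubseteq> b\<rbrakk> \<Longrightarrow> b \<in> filt P"
    and filt_app: "\<lbrakk>a \<in> filt P; b \<in> filt P; app P a b = Some c\<rbrakk> \<Longrightarrow> c \<in> filt P"
    and k_exists:
      "\<exists>k \<in> filt P. \<forall>a \<in> carrier P. \<forall>b \<in> carrier P. def_le P (Some k \<bullet> Some a \<bullet> Some b) a"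
    and s_exists:
      "\<exists>s \<in> filt P. \<forall>a \<in> carrier P. \<forall>b \<in> carrier P.
         Some s \<bullet> Some a \<bullet> Some b \<noteq> None \<and>
         (\<forall>c \<in> carrier P. \<forall>v. Some a \<bullet> Some c \<bullet> (Some b \<bullet> Some c) = Some v \<longrightarrow>
            def_le P (Some s \<bullet> Some a \<bullet> Some b \<bullet> Some c) v)"

definition OPCA :: "('a, 'm) pca_scheme \<Rightarrow> ('b, 'n) pca_scheme \<Rightarrow> ('a \<Rightarrow> 'b) set" where
  "OPCA A B = {f \<in> carrier A \<rightarrow>\<^sub>E carrier B.
     (\<forall>a \<in> filt A. f a \<in> filt B) \<and>
     (\<exists>t \<in> filt B. \<forall>a \<in> carrier A. \<forall>a' \<in> carrier A. \<forall>c.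
        app A a a' = Some c \<longrightarrow> def_le B (Some t \<bullet>\<^bsub>B\<^esub> Some (f a) \<bullet>\<^bsub>B\<^esub> Some (f a')) (f c)) \<and>
     (\<exists>u \<in> filt B. \<forall>a \<in> carrier A. \<forall>a' \<in> carrier A.
        a \<sqsubseteq>\<^bsub>A\<^esub> a' \<longrightarrow> def_le B (app B u (f a)) (f a'))}"

definition OPCA_le ::
  "('a, 'm) pca_scheme \<Rightarrow> ('b, 'n) pca_scheme \<Rightarrow> ('a \<Rightarrow> 'b) \<Rightarrow> ('a \<Rightarrow> 'b) \<Rightarrow> bool" where
  "OPCA_le A B f f' \<longleftrightarrow> (\<exists>s \<in> filt B. \<forall>a \<in> carrier A. def_le B (app B s (f a)) (f' a))"

definition downsets :: "('a, 'm) gorder_scheme \<Rightarrow> 'a set set" where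
  "downsets P = {\<alpha>. \<alpha> \<subseteq> carrier P \<and> (\<forall>x \<in> \<alpha>. \<forall>y \<in> carrier P. y \<sqsubseteq>\<^bsub>P\<^esub> x \<longrightarrow> y \<in> \<alpha>)}"

definition D_app :: "('a, 'm) pca_scheme \<Rightarrow> 'a set \<Rightarrow> 'a set \<Rightarrow> 'a set option" where
  "D_app P \<alpha> \<beta> =
     (if \<forall>x \<in> \<alpha>. \<forall>y \<in> \<beta>. app P x y \<noteq> None
      then Some {z \<in> carrier P. \<exists>x \<in> \<alpha>. \<exists>y \<in> \<beta>. \<exists>v. app P x y = Some v \<and> z \<sqsubseteq>\<^bsub>P\<^esub> v}
      else None)"

definition D_filt :: "('a, 'm) pca_scheme \<Rightarrow> 'a set set" where
  "D_filt P = {\<alpha> \<in> downsets P. \<alpha> \<inter> filt P \<noteq> {}}"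

definition D_arr :: "('a, 'm) pca_scheme \<Rightarrow> 'a set \<Rightarrow> 'a set \<Rightarrow> 'a set" where
  "D_arr P \<alpha> \<beta> = {a \<in> carrier P. \<forall>x \<in> \<alpha>. \<exists>v. app P a x = Some v \<and> v \<in> \<beta>}"

definition D_pca :: "('a, 'm) pca_scheme \<Rightarrow> 'a set pca" where
  "D_pca P = \<lparr>carrier = downsets P, eq = (=), le = (\<subseteq>), app = D_app P, filt = D_filt P\<rparr>"

definition D_alg :: "('a, 'm) pca_scheme \<Rightarrow> 'a set arrow_algebra" where
  "D_alg P = \<lparr>carrier = downsets P, eq = (=), le = (\<subseteq>), arr = D_arr P, sep = D_filt P\<rparr>"

definition OPCA_D :: "('a, 'm) pca_scheme \<Rightarrow> ('b, 'n) pca_scheme \<Rightarrow> ('a \<Rightarrow> 'b set) set" where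
  "OPCA_D A B = OPCA A (D_pca B)"

definition OPCA_D_le ::
  "('a, 'm) pca_scheme \<Rightarrow> ('b, 'n) pca_scheme \<Rightarrow> ('a \<Rightarrow> 'b set) \<Rightarrow> ('a \<Rightarrow> 'b set) \<Rightarrow> bool" where
  "OPCA_D_le A B = OPCA_le A (D_pca B)"

definition OPCA_D_id :: "('a, 'm) pca_scheme \<Rightarrow> 'a \<Rightarrow> 'a set" where
  "OPCA_D_id A = (\<lambda>a \<in> carrier A. {x \<in> carrier A. x \<sqsubseteq>\<^bsub>A\<^esub> a})"

definition OPCA_D_comp ::
  "('a, 'm) pca_scheme \<Rightarrow> ('b \<Rightarrow> 'c set) \<Rightarrow> ('a \<Rightarrow> 'b set) \<Rightarrow> ('a \<Rightarrow> 'c set)" where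
  "OPCA_D_comp A g f = (\<lambda>a \<in> carrier A. \<Union>b \<in> f a. g b)"

definition elem_app :: "('a, 'm) pca_scheme \<Rightarrow> 'a \<Rightarrow> 'a set \<Rightarrow> 'a set option" where
  "elem_app P b \<beta> =
     (if \<forall>x \<in> \<beta>. app P b x \<noteq> None
      then Some {z \<in> carrier P. \<exists>x \<in> \<beta>. \<exists>v. app P b x = Some v \<and> z \<sqsubseteq>\<^bsub>P\<^esub> v}
      else None)"

definition OPCA_D_cd :: "('a, 'm) pca_scheme \<Rightarrow> ('b, 'n) pca_scheme \<Rightarrow> ('a \<Rightarrow> 'b set) set" where
  "OPCA_D_cd A B = {f \<in> OPCA_D A B.
     \<exists>m \<in> filt B. \<forall>s \<in> filt B. \<exists>r \<in> filt A. \<forall>a \<in> carrier A. \<forall>\<gamma>.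
       elem_app B s (f a) = Some \<gamma> \<longrightarrow>
       (\<exists>a' \<gamma>'. app A r a = Some a' \<and> elem_app B m (f a') = Some \<gamma>' \<and> \<gamma>' \<subseteq> \<gamma>)}"

definition D_tilde :: "('a, 'm) pca_scheme \<Rightarrow> ('a \<Rightarrow> 'b set) \<Rightarrow> ('a set \<Rightarrow> 'b set)" where
  "D_tilde A f = (\<lambda>\<alpha> \<in> downsets A. \<Union>a \<in> \<alpha>. f a)"

text \<open>
  A preorder \<open>(X, r)\<close> is seen as a category with at most one morphism between any two objects;
  functors are monotone maps and two objects are isomorphic if each is below the other.
\<close>

definition preorder_equivalence ::
  "'a set \<Rightarrow> ('a \<Rightarrow> 'a \<Rightarrow> bool) \<Rightarrow> 'b set \<Rightarrow> ('b \<Rightarrow> 'b \<Rightarrow> bool) \<Rightarrow> ('a \<Rightarrow> 'b) \<Rightarrow> bool" where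
  "preorder_equivalence X r Y q F \<longleftrightarrow>
     reflp_on X r \<and> transp_on X r \<and> reflp_on Y q \<and> transp_on Y q \<and>
     F \<in> X \<rightarrow> Y \<and> monotone_on X r q F \<and>
     (\<exists>G. G \<in> Y \<rightarrow> X \<and> monotone_on Y q r G \<and>
        (\<forall>x \<in> X. r (G (F x)) x \<and> r x (G (F x))) \<and>
        (\<forall>y \<in> Y. q (F (G y)) y \<and> q y (F (G y))))"

end

theory Submission
  imports Defs
begin

text \<open>
  Write \<open>\<alpha> \<rightarrow> \<beta>\<close> for \<open>D_arr P \<alpha> \<beta>\<close>. In \<open>D P\<close>, application is adjoint to implication:
  \<open>\<tau>\<cdot>\<beta>\<close> is defined and contained in \<open>\<gamma>\<close> iff \<open>\<tau> \<subseteq> \<beta> \<rightarrow> \<gamma>\<close> (\<open>def_le_D_app_iff\<close>). Hence every clause of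
  the definitions that asks for a realizer, on the side of partial combinatory algebras as well as
  on the side of arrow algebras, says that one element of the filter lies in each member of a family of implications
  between downward closed subsets. Such elements are programs, and downward closed subsets serve as
  their types: combinatory completeness yields a program for every term over the filter, and the
  program lies in \<open>\<alpha> \<rightarrow> \<gamma>\<close> as soon as the term takes values in \<open>\<gamma>\<close> on arguments from \<open>\<alpha>\<close>
  (\<open>lambda1_in\<close>, \<open>lambda2_in\<close>). The mathematics then consists of three observations.

  \<^item> Since \<open>f~\<close> preserves unions, it is determined, up to the isomorphism given by the realizer of
  monotonicity of \<open>f\<close>, by its values on the principal downsets \<open>\<down>a\<close>, where it agrees with \<open>f\<close>. So
  \<open>f \<mapsto> f~\<close> both preserves and reflects the order (\<open>D_tilde_le_iff\<close>).

  \<^item> Let \<open>f\<close> be computationally dense with witness \<open>m\<close>. The candidate right adjoint of \<open>f~\<close> is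
  \<open>h \<beta> = {a. m \<in> f a \<rightarrow> \<beta>}\<close>, corrected so as to be downward closed. Its counit is realized by
  \<open>m\<close>. Density says that every program \<open>s \<in> f a \<rightarrow> \<gamma>\<close> is turned into one \<open>r\<close>, depending on \<open>s\<close>
  alone, with \<open>r a \<in> h \<gamma>\<close>. This single principle gives the unit and all clauses in the definition of
  an implicative morphism for \<open>h\<close>; compatibility with implication also uses that \<open>f\<close> can be combined
  with the projections of a pairing (\<open>right_adjoint_in_ArrAlg\<close>, \<open>D_tilde_in_ArrAlg_cd\<close>).

  \<^item> Let \<open>F\<close> be an implicative morphism with right adjoint \<open>h\<close>, unit \<open>\<eta>\<close> and counit \<open>\<epsilon>\<close>, and put
  \<open>f a = F (\<down>a)\<close>. As a left adjoint, \<open>F\<close> preserves the union of the principal downsets contained in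
  \<open>\<alpha>\<close>, so \<open>f~\<close> is isomorphic to \<open>F\<close> (\<open>le_D_tilde_on_principal\<close>). Moreover \<open>f\<close> is dense: a program
  \<open>s \<in> f a \<rightarrow> \<gamma>\<close> is sent by \<open>h\<close> to one in \<open>h (f a) \<rightarrow> h \<gamma>\<close>, which precomposed with \<open>\<eta>\<close> is the
  required \<open>r\<close>; and \<open>F (\<down>(r a)) \<subseteq> F (h \<gamma>)\<close>, up to a realizer, is sent to \<open>\<gamma>\<close> by \<open>\<epsilon>\<close>,
  independently of \<open>s\<close> (\<open>on_principal_in_OPCA_D_cd\<close>).

  That morphisms and dense morphisms are closed under composition is a matter of composing the
  programs involved, where a program that acts inside \<open>f a\<close> is made to act inside \<open>\<Union>b \<in> f a. g b\<close> by
  choosing an element of its image under \<open>g\<close>.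
\<close>

section \<open>Combinatory completeness\<close>

text \<open>
  With downsets as types, this is the typing judgement for possibly undefined expressions.
\<close>

definition value_in :: "'a option \<Rightarrow> 'a set \<Rightarrow> bool" where
  "value_in e \<gamma> \<longleftrightarrow> (\<exists>v \<in> \<gamma>. e = Some v)"

lemma value_in_Some [simp]: "value_in (Some v) \<gamma> \<longleftrightarrow> v \<in> \<gamma>"
  by (simp add: value_in_def)

lemma value_in_mono: "value_in e \<beta> \<Longrightarrow> \<beta> \<subseteq> \<gamma> \<Longrightarrow> value_in e \<gamma>"
  by (auto simp: value_in_def)

lemma papp_Some [simp]: "Some a \<bullet>\<^bsub>P\<^esub> Some b = app P a b"
  by (simp add: papp_def)

lemma papp_eq_Some_iff:
  "x \<bullet>\<^bsub>P\<^esub> y = Some c \<longleftrightarrow> (\<exists>a b. x = Some a \<and> y = Some b \<and> app P a b = Some c)"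
  by (cases x; cases y) (auto simp: papp_def)

lemma D_arr_iff: "a \<in> D_arr P \<alpha> \<beta> \<longleftrightarrow> a \<in> carrier P \<and> (\<forall>x \<in> \<alpha>. value_in (app P a x) \<beta>)"
  by (auto simp: D_arr_def value_in_def)

lemma value_in_papp:
  "value_in e (D_arr P \<alpha> \<beta>) \<Longrightarrow> value_in e' \<alpha> \<Longrightarrow> value_in (e \<bullet>\<^bsub>P\<^esub> e') \<beta>"
  by (auto simp: value_in_def D_arr_def)

lemma value_in_app:
  "a \<in> D_arr P \<alpha> \<beta> \<Longrightarrow> x \<in> \<alpha> \<Longrightarrow> value_in (app P a x) \<beta>"
  by (simp add: D_arr_iff)

lemma downsets_subset: "\<alpha> \<in> downsets P \<Longrightarrow> \<alpha> \<subseteq> carrier P"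
  by (simp add: downsets_def)

lemma D_filt_iff: "\<alpha> \<in> D_filt P \<longleftrightarrow> \<alpha> \<in> downsets P \<and> (\<exists>e \<in> filt P. e \<in> \<alpha>)"
  by (auto simp: D_filt_def)

text \<open>
  Terms are a datatype, with the values of all variables given by one function, so that bracket
  abstraction can be a recursive function and substitution is an update of the valuation. A term that
  is to be closed is evaluated at an arbitrary valuation in the filter, which makes it unnecessary
  to keep track of free variables.
\<close>

datatype 'a pterm = Var nat | Con 'a | App "'a pterm" "'a pterm"

primrec eval :: "('a, 'm) pca_scheme \<Rightarrow> (nat \<Rightarrow> 'a) \<Rightarrow> 'a pterm \<Rightarrow> 'a option" where
  "eval P \<rho> (Var i) = Some (\<rho> i)"
| "eval P \<rho> (Con c) = Some c"
| "eval P \<rho> (App t u) = eval P \<rho> t \<bullet>\<^bsub>P\<^esub> eval P \<rho> u"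

text \<open>
  Bracket abstraction. Constants and other variables are abstracted by \<open>k\<close> one at a time, and
  every application becomes an \<open>s\<close>-redex, also when the bound variable does not occur: as
  \<open>k\<cdot>a\<close> and \<open>s\<cdot>a\<cdot>b\<close> are always defined, so is the value of an abstraction, even if its body is not.
\<close>

primrec lam :: "'a \<Rightarrow> 'a \<Rightarrow> nat \<Rightarrow> 'a pterm \<Rightarrow> 'a pterm" where
  "lam k s i (Var j) = (if i = j then App (App (Con s) (Con k)) (Con k) else App (Con k) (Var j))"
| "lam k s i (Con c) = App (Con k) (Con c)"
| "lam k s i (App t u) = App (App (Con s) (lam k s i t)) (lam k s i u)"

context pca
begin

definition k_comb :: 'a where
  "k_comb = (SOME k. k \<in> filt P \<and>
     (\<forall>a \<in> carrier P. \<forall>b \<in> carrier P. def_le P (Some k \<bullet> Some a \<bullet> Some b) a))"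

definition s_comb :: 'a where
  "s_comb = (SOME s. s \<in> filt P \<and>
     (\<forall>a \<in> carrier P. \<forall>b \<in> carrier P.
         Some s \<bullet> Some a \<bullet> Some b \<noteq> None \<and>
         (\<forall>c \<in> carrier P. \<forall>v. Some a \<bullet> Some c \<bullet> (Some b \<bullet> Some c) = Some v \<longrightarrow>
            def_le P (Some s \<bullet> Some a \<bullet> Some b \<bullet> Some c) v)))"

lemma k_comb_spec:
  "k_comb \<in> filt P \<and>
     (\<forall>a \<in> carrier P. \<forall>b \<in> carrier P. def_le P (Some k_comb \<bullet> Some a \<bullet> Some b) a)"
  unfolding k_comb_def by (rule someI_ex) (use k_exists in blast)

lemma s_comb_spec:
  "s_comb \<in> filt P \<and>
     (\<forall>a \<in> carrier P. \<forall>b \<in> carrier P.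
         Some s_comb \<bullet> Some a \<bullet> Some b \<noteq> None \<and>
         (\<forall>c \<in> carrier P. \<forall>v. Some a \<bullet> Some c \<bullet> (Some b \<bullet> Some c) = Some v \<longrightarrow>
            def_le P (Some s_comb \<bullet> Some a \<bullet> Some b \<bullet> Some c) v))"
  unfolding s_comb_def by (rule someI_ex) (use s_exists in blast)

lemma k_comb_filt: "k_comb \<in> filt P" and s_comb_filt: "s_comb \<in> filt P"
  using k_comb_spec s_comb_spec by auto

lemma k_comb_carrier: "k_comb \<in> carrier P" and s_comb_carrier: "s_comb \<in> carrier P"
  using k_comb_filt s_comb_filt filt_subset by auto

lemma papp_carrier:
  assumes "\<And>a. e = Some a \<Longrightarrow> a \<in> carrier P" "\<And>b. e' = Some b \<Longrightarrow> b \<in> carrier P"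
    and "e \<bullet> e' = Some c"
  shows "c \<in> carrier P"
proof -
  obtain a b where "e = Some a" "e' = Some b" "app P a b = Some c"
    using assms(3) by (auto simp: papp_eq_Some_iff)
  then show ?thesis by (rule app_closed[OF assms(1,2)])
qed

lemma def_le_papp:
  assumes "def_le P e a" "def_le P e' b" "app P a b = Some c"
    and "a \<in> carrier P" "b \<in> carrier P"
    and "\<And>x. e = Some x \<Longrightarrow> x \<in> carrier P" "\<And>x. e' = Some x \<Longrightarrow> x \<in> carrier P"
  shows "def_le P (e \<bullet> e') c"
proof -
  obtain x y where "e = Some x" "x \<sqsubseteq> a" "e' = Some y" "y \<sqsubseteq> b"
    using assms(1,2) by (auto simp: def_le_def)
  then show ?thesis
    using app_mono[of x a y b c] assms by simp
qed

lemma value_in_def_le: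
  assumes "def_le P e v" "v \<in> \<gamma>" "\<gamma> \<in> downsets P" "\<And>x. e = Some x \<Longrightarrow> x \<in> carrier P"
  shows "value_in e \<gamma>"
  using assms by (auto simp: def_le_def value_in_def downsets_def)

lemma eval_carrier:
  assumes "set_pterm t \<subseteq> carrier P" "range \<rho> \<subseteq> carrier P" "eval P \<rho> t = Some v"
  shows "v \<in> carrier P"
  using assms by (induction t arbitrary: v) (auto simp: papp_eq_Some_iff intro: app_closed)

lemma eval_filt:
  assumes "set_pterm t \<subseteq> filt P" "range \<rho> \<subseteq> filt P" "eval P \<rho> t = Some v"
  shows "v \<in> filt P"
  using assms by (induction t arbitrary: v) (auto simp: papp_eq_Some_iff intro: filt_app)

abbreviation abstraction :: "nat \<Rightarrow> 'a pterm \<Rightarrow> 'a pterm" where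
  "abstraction \<equiv> lam k_comb s_comb"

lemma set_abstraction: "set_pterm (abstraction i t) \<subseteq> set_pterm t \<union> {k_comb, s_comb}"
  by (induction t) auto

lemma k_comb_defined: "a \<in> carrier P \<Longrightarrow> \<exists>v \<in> carrier P. app P k_comb a = Some v"
  using bspec[OF bspec[OF conjunct2[OF k_comb_spec]], of a a] app_closed[OF k_comb_carrier]
  by (auto simp: def_le_def papp_eq_Some_iff)

lemma k_comb_reduces:
  "a \<in> carrier P \<Longrightarrow> b \<in> carrier P \<Longrightarrow> app P k_comb a = Some v \<Longrightarrow> def_le P (app P v b) a"
  using bspec[OF bspec[OF conjunct2[OF k_comb_spec]], of a b] by simp

lemma s_comb_defined:
  assumes "a \<in> carrier P" "b \<in> carrier P"
  shows "\<exists>v w. app P s_comb a = Some v \<and> app P v b = Some w \<and> w \<in> carrier P"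
proof -
  obtain w where "Some s_comb \<bullet> Some a \<bullet> Some b = Some w"
    using s_comb_spec assms by blast
  then obtain v where vw: "app P s_comb a = Some v" "app P v b = Some w"
    by (auto simp: papp_eq_Some_iff)
  then have "w \<in> carrier P"
    using app_closed s_comb_carrier assms by blast
  then show ?thesis using vw by blast
qed

lemma s_comb_reduces:
  assumes "a \<in> carrier P" "b \<in> carrier P" "c \<in> carrier P"
    and "app P s_comb a = Some v" "app P v b = Some w" "app P a c \<bullet> app P b c = Some d"
  shows "def_le P (app P w c) d"
proof -
  have "Some a \<bullet> Some c \<bullet> (Some b \<bullet> Some c) = Some d"
    using assms(6) by simp
  then have "def_le P (Some s_comb \<bullet> Some a \<bullet> Some b \<bullet> Some c) d"
    using s_comb_spec assms(1-3) by blast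
  then show ?thesis using assms(4,5) by simp
qed

lemma abstraction_defined:
  assumes "set_pterm t \<subseteq> carrier P" "range \<rho> \<subseteq> carrier P"
  shows "\<exists>e \<in> carrier P. eval P \<rho> (abstraction i t) = Some e"
  using assms(1)
proof (induction t)
  case (Var j)
  have "\<rho> j \<in> carrier P" using assms(2) by blast
  then show ?case
    using k_comb_defined s_comb_defined[OF k_comb_carrier k_comb_carrier] by fastforce
next
  case (Con c)
  then show ?case using k_comb_defined[of c] by auto
next
  case (App t u)
  then obtain a b where "a \<in> carrier P" "eval P \<rho> (abstraction i t) = Some a"
    "b \<in> carrier P" "eval P \<rho> (abstraction i u) = Some b" by auto
  then show ?case using s_comb_defined[of a b] by fastforce
qed

text \<open>
  Beta reduction is only an inequality, as the axioms for \<open>k\<close> and \<open>s\<close> are, and the axiom for \<open>s\<close>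
  makes it available only if the substituted body is defined. Monotonicity of application propagates
  the inequality through the term.
\<close>

lemma abstraction_beta:
  assumes "set_pterm t \<subseteq> carrier P" "range \<rho> \<subseteq> carrier P" "x \<in> carrier P"
    and "eval P (\<rho>(i := x)) t = Some v"
  shows "def_le P (eval P \<rho> (abstraction i t) \<bullet> Some x) v"
  using assms(1,4)
proof (induction t arbitrary: v)
  case (Var j)
  show ?case
  proof (cases "i = j")
    case True
    obtain y where y: "app P k_comb x = Some y" "y \<in> carrier P"
      using k_comb_defined[OF assms(3)] by blast
    then obtain z where z: "app P y y = Some z" "z \<sqsubseteq> x"
      using k_comb_reduces[OF assms(3) y(2,1)] by (auto simp: def_le_def)
    obtain a w where w: "app P s_comb k_comb = Some a" "app P a k_comb = Some w" "w \<in> carrier P"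
      using s_comb_defined[OF k_comb_carrier k_comb_carrier] by blast
    have "def_le P (app P w x) z"
      using s_comb_reduces[OF k_comb_carrier k_comb_carrier assms(3) w(1,2)] y z by simp
    then obtain q where q: "app P w x = Some q" "q \<sqsubseteq> z" by (auto simp: def_le_def)
    moreover have "q \<sqsubseteq> x"
      using le_trans[OF q(2) z(2)] app_closed[OF w(3) assms(3) q(1)]
        app_closed[OF y(2) y(2) z(1)] assms(3) by simp
    ultimately show ?thesis using True w Var by (simp add: def_le_def)
  next
    case False
    then have "v = \<rho> j" using Var by simp
    moreover have j: "\<rho> j \<in> carrier P" using assms(2) by blast
    then obtain y where "app P k_comb (\<rho> j) = Some y"
      using k_comb_defined by blast
    ultimately show ?thesis
      using False k_comb_reduces[OF j assms(3)] by simp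
  qed
next
  case (Con c)
  then have "v = c" and c: "c \<in> carrier P" by simp_all
  moreover obtain y where "app P k_comb c = Some y"
    using k_comb_defined[OF c] by blast
  ultimately show ?case using k_comb_reduces[OF c assms(3)] by simp
next
  case (App t u)
  obtain p q where pq: "eval P (\<rho>(i := x)) t = Some p" "eval P (\<rho>(i := x)) u = Some q"
    "app P p q = Some v"
    using App.prems(2) unfolding eval.simps papp_eq_Some_iff by blast
  obtain a b where ab: "a \<in> carrier P" "eval P \<rho> (abstraction i t) = Some a"
    "b \<in> carrier P" "eval P \<rho> (abstraction i u) = Some b"
    using abstraction_defined[of t \<rho> i] abstraction_defined[of u \<rho> i] App.prems assms(2) by auto
  have ax: "def_le P (app P a x) p" and bx: "def_le P (app P b x) q"
    using App.IH(1)[OF _ pq(1)] App.IH(2)[OF _ pq(2)] App.prems(1) ab by simp_all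
  have \<rho>: "range (\<rho>(i := x)) \<subseteq> carrier P"
    using assms(2,3) by auto
  have "p \<in> carrier P" "q \<in> carrier P"
    using eval_carrier[OF _ \<rho>] pq(1,2) App.prems(1) by auto
  then have "def_le P (app P a x \<bullet> app P b x) v"
    by (rule def_le_papp[OF ax bx pq(3)]) 
      (use \<open>p \<in> carrier P\<close> \<open>q \<in> carrier P\<close> app_closed[OF ab(1) assms(3)]
        app_closed[OF ab(3) assms(3)] in simp_all)
  then obtain d where d: "app P a x \<bullet> app P b x = Some d" "d \<sqsubseteq> v"
    by (auto simp: def_le_def)
  obtain y w where w: "app P s_comb a = Some y" "app P y b = Some w" "w \<in> carrier P"
    using s_comb_defined[OF ab(1,3)] by blast
  then have "def_le P (app P w x) d"
    using s_comb_reduces[OF ab(1,3) assms(3) w(1,2) d(1)] by simp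
  then obtain z where z: "app P w x = Some z" "z \<sqsubseteq> d" by (auto simp: def_le_def)
  have "d \<in> carrier P"
    by (rule papp_carrier[OF _ _ d(1)])
      (use app_closed[OF ab(1) assms(3)] app_closed[OF ab(3) assms(3)] in simp_all)
  moreover have "v \<in> carrier P" "z \<in> carrier P"
    using app_closed[OF \<open>p \<in> carrier P\<close> \<open>q \<in> carrier P\<close> pq(3)] app_closed[OF w(3) assms(3) z(1)]
    by simp_all
  ultimately have "z \<sqsubseteq> v"
    using le_trans[OF z(2) d(2)] by simp
  then show ?case using ab w z by (simp add: def_le_def)
qed

text \<open>
  The introduction rule of the type system. Because of the inequality in the preceding lemma it
  needs types that are downward closed.
\<close>

lemma value_in_abstraction:
  assumes "set_pterm t \<subseteq> carrier P" "range \<rho> \<subseteq> carrier P"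
    and "\<alpha> \<subseteq> carrier P" "\<gamma> \<in> downsets P"
    and "\<And>x. x \<in> \<alpha> \<Longrightarrow> value_in (eval P (\<rho>(i := x)) t) \<gamma>"
  shows "value_in (eval P \<rho> (abstraction i t)) (D_arr P \<alpha> \<gamma>)"
proof -
  obtain e where e: "e \<in> carrier P" "eval P \<rho> (abstraction i t) = Some e"
    using abstraction_defined[OF assms(1,2)] by blast
  have "value_in (app P e x) \<gamma>" if x: "x \<in> \<alpha>" for x
  proof -
    obtain v where "v \<in> \<gamma>" "eval P (\<rho>(i := x)) t = Some v"
      using assms(5)[OF x] by (auto simp: value_in_def)
    moreover have "x \<in> carrier P" using x assms(3) by blast
    ultimately have "def_le P (app P e x) v"
      using abstraction_beta[OF assms(1,2), of x i v] e by simp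
    then show ?thesis
      by (rule value_in_def_le[OF _ \<open>v \<in> \<gamma>\<close> assms(4)])
        (rule app_closed[OF e(1) \<open>x \<in> carrier P\<close>])
  qed
  then show ?thesis using e by (simp add: D_arr_iff)
qed

lemma D_arr_downset:
  assumes "\<alpha> \<subseteq> carrier P" "\<beta> \<in> downsets P"
  shows "D_arr P \<alpha> \<beta> \<in> downsets P"
proof -
  have "a' \<in> D_arr P \<alpha> \<beta>" if a: "a \<in> D_arr P \<alpha> \<beta>" "a' \<in> carrier P" "a' \<sqsubseteq> a" for a a'
  proof -
    have "value_in (app P a' x) \<beta>" if "x \<in> \<alpha>" for x
    proof -
      obtain v where v: "app P a x = Some v" "v \<in> \<beta>"
        using a(1) \<open>x \<in> \<alpha>\<close> by (auto simp: D_arr_def)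
      have x: "x \<in> carrier P" "a \<in> carrier P"
        using a(1) \<open>x \<in> \<alpha>\<close> assms(1) by (auto simp: D_arr_def)
      have "def_le P (app P a' x) v"
        using app_mono[of a' a x x v] x a(2,3) v(1) by simp
      then show ?thesis
        by (rule value_in_def_le[OF _ v(2) assms(2)]) (rule app_closed[OF a(2) x(1)])
    qed
    then show ?thesis using a(2) by (simp add: D_arr_iff)
  qed
  then show ?thesis by (auto simp: downsets_def D_arr_iff)
qed

text \<open>
  The valuation of the remaining variables is constantly \<open>k_comb\<close>; any element of the filter would do.
\<close>

definition lambda1 :: "'a pterm \<Rightarrow> 'a" where
  "lambda1 t = the (eval P (\<lambda>_. k_comb) (abstraction 0 t))"

definition lambda2 :: "'a pterm \<Rightarrow> 'a" where
  "lambda2 t = lambda1 (abstraction 1 t)"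

lemma eval_lambda1:
  assumes "set_pterm t \<subseteq> filt P"
  shows "eval P (\<lambda>_. k_comb) (abstraction 0 t) = Some (lambda1 t)"
proof -
  have "set_pterm t \<subseteq> carrier P" using assms filt_subset by blast
  then show ?thesis
    using abstraction_defined[of t "\<lambda>_. k_comb" 0] k_comb_carrier by (auto simp: lambda1_def)
qed

lemma lambda1_filt:
  assumes "set_pterm t \<subseteq> filt P"
  shows "lambda1 t \<in> filt P"
proof -
  have "set_pterm (abstraction 0 t) \<subseteq> filt P"
    using set_abstraction[of 0 t] assms k_comb_filt s_comb_filt by auto
  then show ?thesis
    using eval_filt[of "abstraction 0 t" "\<lambda>_. k_comb"] k_comb_filt eval_lambda1[OF assms] by auto
qed

lemma set_abstraction_filt: "set_pterm t \<subseteq> filt P \<Longrightarrow> set_pterm (abstraction i t) \<subseteq> filt P"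
  using set_abstraction[of i t] k_comb_filt s_comb_filt by auto

lemma lambda2_filt: "set_pterm t \<subseteq> filt P \<Longrightarrow> lambda2 t \<in> filt P"
  unfolding lambda2_def by (intro lambda1_filt set_abstraction_filt)

lemma lambda1_in:
  assumes "set_pterm t \<subseteq> filt P" "\<alpha> \<in> downsets P" "\<gamma> \<in> downsets P"
    and "\<And>\<rho>. \<rho> 0 \<in> \<alpha> \<Longrightarrow> range \<rho> \<subseteq> carrier P \<Longrightarrow> value_in (eval P \<rho> t) \<gamma>"
  shows "lambda1 t \<in> D_arr P \<alpha> \<gamma>"
proof -
  have "value_in (eval P (\<lambda>_. k_comb) (abstraction 0 t)) (D_arr P \<alpha> \<gamma>)"
  proof (rule value_in_abstraction)
    fix x assume x: "x \<in> \<alpha>"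
    have "range ((\<lambda>_. k_comb)(0 := x)) \<subseteq> carrier P"
      using x downsets_subset[OF assms(2)] k_comb_carrier by auto
    then show "value_in (eval P ((\<lambda>_. k_comb)(0 := x)) t) \<gamma>"
      by (intro assms(4)) (use x in simp)
  qed (use assms(1,3) downsets_subset[OF assms(2)] k_comb_carrier filt_subset in auto)
  then show ?thesis using eval_lambda1[OF assms(1)] by simp
qed

lemma lambda2_in:
  assumes t: "set_pterm t \<subseteq> filt P" and d: "\<alpha> \<in> downsets P" "\<beta> \<in> downsets P" "\<gamma> \<in> downsets P"
    and v: "\<And>\<rho>. \<rho> 0 \<in> \<alpha> \<Longrightarrow> \<rho> 1 \<in> \<beta> \<Longrightarrow> range \<rho> \<subseteq> carrier P \<Longrightarrow> value_in (eval P \<rho> t) \<gamma>"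
  shows "lambda2 t \<in> D_arr P \<alpha> (D_arr P \<beta> \<gamma>)"
  unfolding lambda2_def
proof (rule lambda1_in)
  show "D_arr P \<beta> \<gamma> \<in> downsets P" by (rule D_arr_downset[OF downsets_subset[OF d(2)] d(3)])
next
  note sub = downsets_subset[OF d(2)]
  fix \<rho> :: "nat \<Rightarrow> 'a"
  assume \<rho>: "\<rho> 0 \<in> \<alpha>" "range \<rho> \<subseteq> carrier P"
  show "value_in (eval P \<rho> (abstraction 1 t)) (D_arr P \<beta> \<gamma>)"
  proof (rule value_in_abstraction[OF _ \<rho>(2) sub d(3)])
    fix y assume y: "y \<in> \<beta>"
    have "range (\<rho>(1 := y)) \<subseteq> carrier P" using \<rho>(2) y sub by auto
    then show "value_in (eval P (\<rho>(1 := y)) t) \<gamma>"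
      by (intro v) (use \<rho>(1) y in simp_all)
  qed (use t filt_subset in auto)
next
  show "set_pterm (abstraction 1 t) \<subseteq> filt P" by (rule set_abstraction_filt[OF t])
qed (rule d(1))

lemma id_in: "\<alpha> \<in> downsets P \<Longrightarrow> \<gamma> \<in> downsets P \<Longrightarrow> \<alpha> \<subseteq> \<gamma> \<Longrightarrow> lambda1 (Var 0) \<in> D_arr P \<alpha> \<gamma>"
  by (rule lambda1_in) auto

end

section \<open>The arrow algebra of downward closed subsets\<close>

lemma D_alg_simps [simp]:
  "carrier (D_alg P) = downsets P" "le (D_alg P) = (\<subseteq>)" "eq (D_alg P) = (=)"
  "arr (D_alg P) = D_arr P" "sep (D_alg P) = D_filt P"
  by (simp_all add: D_alg_def)

lemma D_pca_simps [simp]: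
  "carrier (D_pca P) = downsets P" "le (D_pca P) = (\<subseteq>)" "eq (D_pca P) = (=)"
  "app (D_pca P) = D_app P" "filt (D_pca P) = D_filt P"
  by (simp_all add: D_pca_def)

lemma greatest_D_alg:
  assumes "X \<subseteq> downsets P"
  shows "greatest (D_alg P) (carrier P \<inter> \<Inter>X) (Lower (D_alg P) X)"
proof -
  have "carrier P \<inter> \<Inter>X \<in> downsets P"
    using assms by (auto simp: downsets_def)
  moreover have "\<beta> \<subseteq> \<xi>" if "\<beta> \<in> Lower (D_alg P) X" "\<xi> \<in> X" for \<beta> \<xi>
    using that assms by (auto simp: Lower_def)
  moreover have "\<beta> \<subseteq> carrier P" if "\<beta> \<in> Lower (D_alg P) X" for \<beta>
    using that by (auto simp: Lower_def dest: downsets_subset)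
  ultimately show ?thesis
    by (auto simp: greatest_def Lower_def)
qed

text \<open>
  The order on \<open>D_alg P\<close> is inclusion, but the empty meet is the carrier and not the universe of the
  type.
\<close>

lemma inf_D_alg:
  assumes "X \<subseteq> downsets P"
  shows "\<Sqinter>\<^bsub>D_alg P\<^esub>X = carrier P \<inter> \<Inter>X"
  unfolding inf_def
proof (rule some_equality)
  fix i assume i: "greatest (D_alg P) i (Lower (D_alg P) X)"
  have "l \<subseteq> j" if "greatest (D_alg P) j (Lower (D_alg P) X)" "greatest (D_alg P) l (Lower (D_alg P) X)"
    for j l
    using that unfolding greatest_def D_alg_simps by blast
  then show "i = carrier P \<inter> \<Inter>X"
    using i greatest_D_alg[OF assms] by blast
qed (rule greatest_D_alg[OF assms])

context pca
begin

text \<open>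
  In this form the preservation of uniformly realized families by implicative morphisms, and the
  order on implicative morphisms, become statements about single realizers.
\<close>

lemma inf_in_D_filt_iff:
  assumes "X \<subseteq> downsets P"
  shows "\<Sqinter>\<^bsub>D_alg P\<^esub>X \<in> D_filt P \<longleftrightarrow> (\<exists>e \<in> filt P. \<forall>\<xi> \<in> X. e \<in> \<xi>)"
proof -
  have "carrier P \<inter> \<Inter>X \<in> downsets P"
    using greatest_D_alg[OF assms] by (auto simp: greatest_def Lower_def)
  then show ?thesis
    unfolding inf_D_alg[OF assms] D_filt_iff using subsetD[OF filt_subset] by auto
qed

lemma inf_in_D_filtI:
  assumes "e \<in> filt P" "\<And>\<xi>. \<xi> \<in> X \<Longrightarrow> \<xi> \<in> downsets P \<and> e \<in> \<xi>"
  shows "\<Sqinter>\<^bsub>D_alg P\<^esub>X \<in> D_filt P"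
proof -
  have "X \<subseteq> downsets P" using assms(2) by blast
  from inf_in_D_filt_iff[OF this] show ?thesis using assms by blast
qed

lemma arr_downset [simp]: "\<alpha> \<in> downsets P \<Longrightarrow> \<beta> \<in> downsets P \<Longrightarrow> D_arr P \<alpha> \<beta> \<in> downsets P"
  by (intro D_arr_downset downsets_subset)

lemma D_arr_mono:
  "\<alpha>' \<subseteq> \<alpha> \<Longrightarrow> \<beta> \<subseteq> \<beta>' \<Longrightarrow> D_arr P \<alpha> \<beta> \<subseteq> D_arr P \<alpha>' \<beta>'"
  using value_in_mono[of _ \<beta> \<beta>'] unfolding subset_iff D_arr_iff by blast

lemma inf_downset [simp]: "X \<subseteq> downsets P \<Longrightarrow> \<Sqinter>\<^bsub>D_alg P\<^esub>X \<in> downsets P"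
  using greatest_D_alg[of X P] inf_D_alg[of X P] by (auto simp: greatest_def Lower_def)

text \<open>
  The realizers of the three combinators are the programs \<open>\<lambda>x y. x\<close>, \<open>\<lambda>x y z. x z (y z)\<close> and
  \<open>\<lambda>x y z. x y z\<close>. The last one is not the identity: in \<open>sep_a\<close> the family may be empty,
  and then its realizer has to be defined on two arbitrary arguments.
\<close>

lemma arrow_algebra_D_alg: "arrow_algebra (D_alg P)"
proof -
  interpret partial_order "D_alg P"
    by unfold_locales auto
  show ?thesis
  proof
    fix X assume "X \<subseteq> carrier (D_alg P)"
    then show "\<exists>i. greatest (D_alg P) i (Lower (D_alg P) X)"
      using greatest_D_alg by force
  next
    fix \<alpha> \<beta>
    assume "\<alpha> \<in> carrier (D_alg P)" "\<beta> \<in> carrier (D_alg P)"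
      "\<alpha> \<leadsto>\<^bsub>D_alg P\<^esub> \<beta> \<in> sep (D_alg P)" "\<alpha> \<in> sep (D_alg P)"
    then obtain e x where ex: "e \<in> filt P" "e \<in> D_arr P \<alpha> \<beta>" "x \<in> filt P" "x \<in> \<alpha>"
      by (auto simp: D_filt_iff)
    then obtain v where v: "app P e x = Some v" "v \<in> \<beta>"
      by (auto simp: D_arr_def)
    show "\<beta> \<in> sep (D_alg P)"
      using filt_app[OF ex(1,3) v(1)] v(2) \<open>\<beta> \<in> carrier (D_alg P)\<close> by (auto simp: D_filt_iff)
  next
    have "lambda2 (Var 0) \<in> filt P"
      by (rule lambda2_filt) simp
    then show "\<Sqinter>\<^bsub>D_alg P\<^esub>{a \<leadsto>\<^bsub>D_alg P\<^esub> b \<leadsto>\<^bsub>D_alg P\<^esub> a | a b.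
        a \<in> carrier (D_alg P) \<and> b \<in> carrier (D_alg P)} \<in> sep (D_alg P)"
      unfolding D_alg_simps by (rule inf_in_D_filtI) (auto intro!: lambda2_in)
  next
    let ?X = "{D_arr P (D_arr P a (D_arr P b c)) (D_arr P (D_arr P a b) (D_arr P a c)) | a b c.
        a \<in> downsets P \<and> b \<in> downsets P \<and> c \<in> downsets P}"
    let ?t = "abstraction 2 (App (App (Var 0) (Var 2)) (App (Var 1) (Var 2)))"
    have t: "set_pterm ?t \<subseteq> filt P"
      by (rule set_abstraction_filt) simp
    have "\<xi> \<in> downsets P \<and> lambda2 ?t \<in> \<xi>" if "\<xi> \<in> ?X" for \<xi>
    proof -
      obtain a b c where d: "a \<in> downsets P" "b \<in> downsets P" "c \<in> downsets P"
        and \<xi>: "\<xi> = D_arr P (D_arr P a (D_arr P b c)) (D_arr P (D_arr P a b) (D_arr P a c))"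
        using \<open>\<xi> \<in> ?X\<close> by blast
      have "lambda2 ?t \<in> \<xi>" unfolding \<xi>
      proof (rule lambda2_in[OF t])
        fix \<rho> :: "nat \<Rightarrow> 'a"
        assume \<rho>: "\<rho> 0 \<in> D_arr P a (D_arr P b c)" "\<rho> 1 \<in> D_arr P a b" "range \<rho> \<subseteq> carrier P"
        show "value_in (eval P \<rho> ?t) (D_arr P a c)"
        proof (rule value_in_abstraction[OF _ \<rho>(3) downsets_subset[OF d(1)] d(3)])
          fix x assume "x \<in> a"
          then show "value_in (eval P (\<rho>(2 := x)) (App (App (Var 0) (Var 2)) (App (Var 1) (Var 2)))) c"
            using value_in_papp[OF value_in_app[OF \<rho>(1)] value_in_app[OF \<rho>(2)]] by simp
        qed simp
      qed (use d in auto)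
      then show ?thesis using d \<xi> by simp
    qed
    then have "\<Sqinter>\<^bsub>D_alg P\<^esub>?X \<in> D_filt P"
      by (rule inf_in_D_filtI[OF lambda2_filt[OF t]])
    then
    show "\<Sqinter>\<^bsub>D_alg P\<^esub>{(a \<leadsto>\<^bsub>D_alg P\<^esub> b \<leadsto>\<^bsub>D_alg P\<^esub> c) \<leadsto>\<^bsub>D_alg P\<^esub> (a \<leadsto>\<^bsub>D_alg P\<^esub> b) \<leadsto>\<^bsub>D_alg P\<^esub> a \<leadsto>\<^bsub>D_alg P\<^esub> c
        | a b c. a \<in> carrier (D_alg P) \<and> b \<in> carrier (D_alg P) \<and> c \<in> carrier (D_alg P)}
      \<in> sep (D_alg P)"
      by simp
  next
    let ?R1 = "\<lambda>a R. {D_arr P a (D_arr P b c) | b c. (b, c) \<in> R}"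
    let ?R2 = "\<lambda>R. {D_arr P b c | b c. (b, c) \<in> R}"
    let ?X = "{D_arr P (\<Sqinter>\<^bsub>D_alg P\<^esub>(?R1 a R)) (D_arr P a (\<Sqinter>\<^bsub>D_alg P\<^esub>(?R2 R))) | a R.
          a \<in> downsets P \<and> R \<subseteq> downsets P \<times> downsets P}"
    let ?t = "abstraction 2 (App (App (Var 0) (Var 1)) (Var 2))"
    have t: "set_pterm ?t \<subseteq> filt P"
      by (rule set_abstraction_filt) simp
    have mem: "\<xi> \<in> downsets P \<and> lambda2 ?t \<in> \<xi>" if "\<xi> \<in> ?X" for \<xi>
    proof -
      obtain a R where d: "a \<in> downsets P" "R \<subseteq> downsets P \<times> downsets P"
        and \<xi>: "\<xi> = D_arr P (\<Sqinter>\<^bsub>D_alg P\<^esub>(?R1 a R)) (D_arr P a (\<Sqinter>\<^bsub>D_alg P\<^esub>(?R2 R)))"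
        using \<open>\<xi> \<in> ?X\<close> by blast
      have R: "?R1 a R \<subseteq> downsets P" "?R2 R \<subseteq> downsets P"
        using d by auto
      have "lambda2 ?t \<in> \<xi>" unfolding \<xi>
      proof (rule lambda2_in[OF t])
        fix \<rho> :: "nat \<Rightarrow> 'a"
        assume \<rho>: "\<rho> 0 \<in> \<Sqinter>\<^bsub>D_alg P\<^esub>(?R1 a R)" "\<rho> 1 \<in> a" "range \<rho> \<subseteq> carrier P"
        obtain v where v: "v \<in> carrier P" "eval P \<rho> ?t = Some v"
          using abstraction_defined[OF _ \<rho>(3), of "App (App (Var 0) (Var 1)) (Var 2)" 2] by auto
        have "v \<in> D_arr P b c" if bc: "(b, c) \<in> R" for b c
        proof -
          have 0: "\<rho> 0 \<in> D_arr P a (D_arr P b c)"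
            using \<rho>(1) bc unfolding inf_D_alg[OF R(1)] by blast
          have b: "b \<subseteq> carrier P" and c: "c \<in> downsets P"
            using d(2) bc by (auto simp: downsets_def)
          have "value_in (eval P \<rho> ?t) (D_arr P b c)"
          proof (rule value_in_abstraction[OF _ \<rho>(3) b c])
            fix x assume "x \<in> b"
            then show "value_in (eval P (\<rho>(2 := x)) (App (App (Var 0) (Var 1)) (Var 2))) c"
              using value_in_papp[OF value_in_app[OF 0 \<rho>(2)], of "Some x"] by simp
          qed simp
          then show ?thesis using v by simp
        qed
        \<comment> \<open>for empty \<open>R\<close> this rests on the abstraction being defined\<close>
        then show "value_in (eval P \<rho> ?t) (\<Sqinter>\<^bsub>D_alg P\<^esub>(?R2 R))"
          unfolding inf_D_alg[OF R(2)] using v by auto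
      qed (use d R in auto)
      then show ?thesis using \<xi> d R by simp
    qed
    have "\<Sqinter>\<^bsub>D_alg P\<^esub>?X \<in> D_filt P"
      by (rule inf_in_D_filtI[OF lambda2_filt[OF t] mem])
    then
    show "\<Sqinter>\<^bsub>D_alg P\<^esub>{\<Sqinter>\<^bsub>D_alg P\<^esub>{a \<leadsto>\<^bsub>D_alg P\<^esub> b \<leadsto>\<^bsub>D_alg P\<^esub> c | b c. (b, c) \<in> R} \<leadsto>\<^bsub>D_alg P\<^esub> a
         \<leadsto>\<^bsub>D_alg P\<^esub> \<Sqinter>\<^bsub>D_alg P\<^esub>{b \<leadsto>\<^bsub>D_alg P\<^esub> c | b c. (b, c) \<in> R} | a R.
          a \<in> carrier (D_alg P) \<and> R \<subseteq> carrier (D_alg P) \<times> carrier (D_alg P)} \<in> sep (D_alg P)"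
      by simp
  qed (use D_arr_mono in \<open>auto simp: D_filt_iff\<close>)
qed

end

section \<open>Morphisms in terms of single realizers\<close>

definition down :: "('a, 'm) pca_scheme \<Rightarrow> 'a \<Rightarrow> 'a set" where
  "down P a = {x \<in> carrier P. x \<sqsubseteq>\<^bsub>P\<^esub> a}"

context pca
begin

lemma down_downset [simp]: "a \<in> carrier P \<Longrightarrow> down P a \<in> downsets P"
  by (auto simp: down_def downsets_def intro: le_trans)

lemma down_self [simp]: "a \<in> carrier P \<Longrightarrow> a \<in> down P a"
  by (simp add: down_def)

lemma down_subset: "a \<in> \<alpha> \<Longrightarrow> \<alpha> \<in> downsets P \<Longrightarrow> down P a \<subseteq> \<alpha>"
  by (auto simp: down_def downsets_def)

lemma down_mono: "a \<in> carrier P \<Longrightarrow> b \<in> carrier P \<Longrightarrow> a \<sqsubseteq> b \<Longrightarrow> down P a \<subseteq> down P b"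
  by (auto simp: down_def intro: le_trans)

text \<open>
  A realizer in \<open>D P\<close> is a downset that meets the filter; it may be traded for one of its elements in
  the filter, and conversely an element for the principal downset below it.
\<close>

lemma ex_D_filt_iff:
  assumes "\<And>i. Q i \<Longrightarrow> S i \<in> downsets P"
  shows "(\<exists>\<tau> \<in> D_filt P. \<forall>i. Q i \<longrightarrow> \<tau> \<subseteq> S i) \<longleftrightarrow> (\<exists>e \<in> filt P. \<forall>i. Q i \<longrightarrow> e \<in> S i)"
proof
  assume "\<exists>e \<in> filt P. \<forall>i. Q i \<longrightarrow> e \<in> S i"
  then obtain e where e: "e \<in> filt P" "\<forall>i. Q i \<longrightarrow> e \<in> S i" by blast
  then have "e \<in> carrier P" using filt_subset by blast
  then have "down P e \<in> D_filt P"
    using e(1) down_self by (auto simp: D_filt_iff simp del: down_self)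
  moreover have "\<forall>i. Q i \<longrightarrow> down P e \<subseteq> S i"
    using e assms down_subset by blast
  ultimately show "\<exists>\<tau> \<in> D_filt P. \<forall>i. Q i \<longrightarrow> \<tau> \<subseteq> S i" by blast
next
  assume "\<exists>\<tau> \<in> D_filt P. \<forall>i. Q i \<longrightarrow> \<tau> \<subseteq> S i"
  then obtain \<tau> e where "\<forall>i. Q i \<longrightarrow> \<tau> \<subseteq> S i" "e \<in> filt P" "e \<in> \<tau>"
    by (auto simp: D_filt_iff)
  then show "\<exists>e \<in> filt P. \<forall>i. Q i \<longrightarrow> e \<in> S i" by blast
qed

lemma D_app_downset:
  assumes "\<tau> \<subseteq> carrier P" "\<beta> \<subseteq> carrier P" "D_app P \<tau> \<beta> = Some \<delta>"
  shows "\<delta> \<in> downsets P"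
proof -
  have \<delta>: "\<delta> = {z \<in> carrier P. \<exists>x \<in> \<tau>. \<exists>y \<in> \<beta>. \<exists>v. app P x y = Some v \<and> z \<sqsubseteq> v}"
    using assms(3) by (simp add: D_app_def split: if_splits)
  have "z' \<in> \<delta>" if "z \<in> \<delta>" "z' \<in> carrier P" "z' \<sqsubseteq> z" for z z'
  proof -
    obtain x y v where "x \<in> \<tau>" "y \<in> \<beta>" "app P x y = Some v" "z \<sqsubseteq> v" "z \<in> carrier P"
      using \<open>z \<in> \<delta>\<close> \<delta> by blast
    moreover have "v \<in> carrier P"
      by (rule app_closed[OF _ _ \<open>app P x y = Some v\<close>]) (use calculation assms in auto)
    ultimately show ?thesis
      using that(2,3) \<delta> le_trans by blast
  qed
  then show ?thesis using \<delta> by (auto simp: downsets_def)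
qed

text \<open>
  Application is left adjoint to implication. The downward closure in the definition of the product
  does no harm, because \<open>\<gamma>\<close> is a downset.
\<close>

lemma def_le_D_app_iff:
  assumes "\<tau> \<subseteq> carrier P" "\<beta> \<subseteq> carrier P" "\<gamma> \<in> downsets P"
  shows "def_le (D_pca P) (D_app P \<tau> \<beta>) \<gamma> \<longleftrightarrow> \<tau> \<subseteq> D_arr P \<beta> \<gamma>"
proof
  assume L: "def_le (D_pca P) (D_app P \<tau> \<beta>) \<gamma>"
  show "\<tau> \<subseteq> D_arr P \<beta> \<gamma>"
  proof
    fix x assume x: "x \<in> \<tau>"
    have "value_in (app P x y) \<gamma>" if y: "y \<in> \<beta>" for y
    proof -
      obtain v where v: "app P x y = Some v"
        using L x y by (force simp: def_le_def D_app_def split: if_splits)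
      moreover have "v \<in> carrier P"
        by (rule app_closed[OF _ _ v]) (use assms x y in auto)
      then have "v \<in> \<gamma>"
        using L x y v le_refl by (fastforce simp: def_le_def D_app_def split: if_splits)
      ultimately show ?thesis by simp
    qed
    then show "x \<in> D_arr P \<beta> \<gamma>" using x assms(1) by (auto simp: D_arr_iff)
  qed
next
  assume R: "\<tau> \<subseteq> D_arr P \<beta> \<gamma>"
  have R': "\<exists>v. app P x y = Some v \<and> v \<in> \<gamma>" if "x \<in> \<tau>" "y \<in> \<beta>" for x y
    using R that by (auto simp: D_arr_def)
  have "z \<in> \<gamma>" if "z \<in> carrier P" "x \<in> \<tau>" "y \<in> \<beta>" "app P x y = Some v" "z \<sqsubseteq> v" for z x y v
    using R'[OF that(2,3)] that(1,4,5) assms(3) by (auto simp: downsets_def)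
  then have "{z \<in> carrier P. \<exists>x \<in> \<tau>. \<exists>y \<in> \<beta>. \<exists>v. app P x y = Some v \<and> z \<sqsubseteq> v} \<subseteq> \<gamma>"
    by blast
  moreover have "\<forall>x \<in> \<tau>. \<forall>y \<in> \<beta>. app P x y \<noteq> None"
    using R' by fastforce
  ultimately show "def_le (D_pca P) (D_app P \<tau> \<beta>) \<gamma>"
    by (simp add: def_le_def D_app_def)
qed

lemma def_le_D_app2_iff:
  assumes "\<tau> \<subseteq> carrier P" "\<beta> \<subseteq> carrier P" "\<beta>' \<subseteq> carrier P" "\<gamma> \<in> downsets P"
  shows "def_le (D_pca P) (Some \<tau> \<bullet>\<^bsub>D_pca P\<^esub> Some \<beta> \<bullet>\<^bsub>D_pca P\<^esub> Some \<beta>') \<gamma> \<longleftrightarrow>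
    \<tau> \<subseteq> D_arr P \<beta> (D_arr P \<beta>' \<gamma>)" (is "?L \<longleftrightarrow> ?R")
proof -
  have "?L \<longleftrightarrow> (\<exists>\<delta>. D_app P \<tau> \<beta> = Some \<delta> \<and> def_le (D_pca P) (D_app P \<delta> \<beta>') \<gamma>)"
    by (auto simp: def_le_def papp_eq_Some_iff)
  also have "\<dots> \<longleftrightarrow> (\<exists>\<delta>. D_app P \<tau> \<beta> = Some \<delta> \<and> \<delta> \<subseteq> D_arr P \<beta>' \<gamma>)"
    using def_le_D_app_iff[OF downsets_subset assms(3,4)] D_app_downset[OF assms(1,2)] by blast
  also have "\<dots> \<longleftrightarrow> def_le (D_pca P) (D_app P \<tau> \<beta>) (D_arr P \<beta>' \<gamma>)"
    by (auto simp: def_le_def)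
  also have "\<dots> \<longleftrightarrow> ?R"
    by (rule def_le_D_app_iff[OF assms(1,2) D_arr_downset[OF assms(3,4)]])
  finally show ?thesis .
qed

text \<open>
  Although \<open>{b}\<close> is usually not downward closed, it gives the same products as \<open>b\<close>, which reduces
  products with elements to products of subsets.
\<close>

lemma elem_app_eq_D_app: "elem_app P b \<beta> = D_app P {b} \<beta>"
  by (simp add: elem_app_def D_app_def cong: if_cong)

lemma elem_app_le_iff:
  assumes "b \<in> carrier P" "\<beta> \<subseteq> carrier P" "\<gamma> \<in> downsets P"
  shows "(\<exists>\<delta>. elem_app P b \<beta> = Some \<delta> \<and> \<delta> \<subseteq> \<gamma>) \<longleftrightarrow> b \<in> D_arr P \<beta> \<gamma>"
  using def_le_D_app_iff[of "{b}" \<beta> \<gamma>] assms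
  by (simp add: def_le_def elem_app_eq_D_app)

lemma elem_app_downset:
  assumes "b \<in> carrier P" "\<beta> \<subseteq> carrier P" "elem_app P b \<beta> = Some \<delta>"
  shows "\<delta> \<in> downsets P"
  using D_app_downset[of "{b}" \<beta> \<delta>] assms by (simp add: elem_app_eq_D_app)

end

locale pca_pair = A: pca A + B: pca B
  for A :: "('a, 'm) pca_scheme" and B :: "('b, 'n) pca_scheme"
begin

lemma OPCA_D_iff:
  "f \<in> OPCA_D A B \<longleftrightarrow> f \<in> carrier A \<rightarrow>\<^sub>E downsets B \<and> (\<forall>a \<in> filt A. f a \<in> D_filt B) \<and>
     (\<exists>t \<in> filt B. \<forall>a \<in> carrier A. \<forall>a' \<in> carrier A. \<forall>c. app A a a' = Some c \<longrightarrow>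
        t \<in> D_arr B (f a) (D_arr B (f a') (f c))) \<and>
     (\<exists>u \<in> filt B. \<forall>a \<in> carrier A. \<forall>a' \<in> carrier A. a \<sqsubseteq>\<^bsub>A\<^esub> a' \<longrightarrow> u \<in> D_arr B (f a) (f a'))"
proof (cases "f \<in> carrier A \<rightarrow>\<^sub>E downsets B")
  case True
  have d: "f a \<in> downsets B" "f a \<subseteq> carrier B" if "a \<in> carrier A" for a
    using True that downsets_subset by blast+
  have D: "\<tau> \<subseteq> carrier B" if "\<tau> \<in> D_filt B" for \<tau>
    using that by (simp add: D_filt_iff downsets_subset)
  have c: "c \<in> carrier A" if "a \<in> carrier A" "a' \<in> carrier A" "app A a a' = Some c" for a a' c
    by (rule A.app_closed[OF that])
  have e1: "def_le (D_pca B) (Some \<tau> \<bullet>\<^bsub>D_pca B\<^esub> Some (f a) \<bullet>\<^bsub>D_pca B\<^esub> Some (f a')) (f c) \<longleftrightarrow>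
      \<tau> \<subseteq> D_arr B (f a) (D_arr B (f a') (f c))"
    if "\<tau> \<in> D_filt B" "a \<in> carrier A" "a' \<in> carrier A" "app A a a' = Some c" for \<tau> a a' c
    by (rule B.def_le_D_app2_iff[OF D[OF that(1)] d(2)[OF that(2)] d(2)[OF that(3)] d(1)[OF c[OF that(2-4)]]])
  have e2: "def_le (D_pca B) (D_app B \<tau> (f a)) (f a') \<longleftrightarrow> \<tau> \<subseteq> D_arr B (f a) (f a')"
    if "\<tau> \<in> D_filt B" "a \<in> carrier A" "a' \<in> carrier A" for \<tau> a a'
    by (rule B.def_le_D_app_iff[OF D[OF that(1)] d(2)[OF that(2)] d(1)[OF that(3)]])
  let ?Q = "\<lambda>(a, a', c). a \<in> carrier A \<and> a' \<in> carrier A \<and> app A a a' = Some c"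
  let ?S = "\<lambda>(a, a', c). D_arr B (f a) (D_arr B (f a') (f c))"
  have "(\<exists>\<tau> \<in> D_filt B. \<forall>a \<in> carrier A. \<forall>a' \<in> carrier A. \<forall>c. app A a a' = Some c \<longrightarrow>
      def_le (D_pca B) (Some \<tau> \<bullet>\<^bsub>D_pca B\<^esub> Some (f a) \<bullet>\<^bsub>D_pca B\<^esub> Some (f a')) (f c)) \<longleftrightarrow>
    (\<exists>\<tau> \<in> D_filt B. \<forall>i. ?Q i \<longrightarrow> \<tau> \<subseteq> ?S i)"
    by (rule bex_cong[OF refl]) (auto simp: e1 simp del: papp_Some)
  also have "\<dots> \<longleftrightarrow> (\<exists>t \<in> filt B. \<forall>i. ?Q i \<longrightarrow> t \<in> ?S i)"
  proof (rule B.ex_D_filt_iff)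
    fix i assume "?Q i"
    then obtain a a' c0 where "i = (a, a', c0)" "a \<in> carrier A" "a' \<in> carrier A" "app A a a' = Some c0"
      by auto
    then show "?S i \<in> downsets B"
      using d(1) c[of a a' c0] by simp
  qed
  also have "\<dots> \<longleftrightarrow> (\<exists>t \<in> filt B. \<forall>a \<in> carrier A. \<forall>a' \<in> carrier A. \<forall>c. app A a a' = Some c \<longrightarrow>
        t \<in> D_arr B (f a) (D_arr B (f a') (f c)))"
    by (rule bex_cong[OF refl]) auto
  finally have 1: "(\<exists>\<tau> \<in> D_filt B. \<forall>a \<in> carrier A. \<forall>a' \<in> carrier A. \<forall>c. app A a a' = Some c \<longrightarrow>
      def_le (D_pca B) (Some \<tau> \<bullet>\<^bsub>D_pca B\<^esub> Some (f a) \<bullet>\<^bsub>D_pca B\<^esub> Some (f a')) (f c)) \<longleftrightarrow>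
    (\<exists>t \<in> filt B. \<forall>a \<in> carrier A. \<forall>a' \<in> carrier A. \<forall>c. app A a a' = Some c \<longrightarrow>
        t \<in> D_arr B (f a) (D_arr B (f a') (f c)))" .
  let ?Q = "\<lambda>(a, a'). a \<in> carrier A \<and> a' \<in> carrier A \<and> a \<sqsubseteq>\<^bsub>A\<^esub> a'"
  let ?S = "\<lambda>(a, a'). D_arr B (f a) (f a')"
  have "(\<exists>\<tau> \<in> D_filt B. \<forall>a \<in> carrier A. \<forall>a' \<in> carrier A. a \<sqsubseteq>\<^bsub>A\<^esub> a' \<longrightarrow>
      def_le (D_pca B) (D_app B \<tau> (f a)) (f a')) \<longleftrightarrow>
    (\<exists>\<tau> \<in> D_filt B. \<forall>i. ?Q i \<longrightarrow> \<tau> \<subseteq> ?S i)"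
    by (rule bex_cong[OF refl]) (auto simp: e2)
  also have "\<dots> \<longleftrightarrow> (\<exists>t \<in> filt B. \<forall>i. ?Q i \<longrightarrow> t \<in> ?S i)"
    by (rule B.ex_D_filt_iff) (use d in auto)
  also have "\<dots> \<longleftrightarrow> (\<exists>u \<in> filt B. \<forall>a \<in> carrier A. \<forall>a' \<in> carrier A. a \<sqsubseteq>\<^bsub>A\<^esub> a' \<longrightarrow>
        u \<in> D_arr B (f a) (f a'))"
    by (rule bex_cong[OF refl]) auto
  finally have 2: "(\<exists>\<tau> \<in> D_filt B. \<forall>a \<in> carrier A. \<forall>a' \<in> carrier A. a \<sqsubseteq>\<^bsub>A\<^esub> a' \<longrightarrow>
      def_le (D_pca B) (D_app B \<tau> (f a)) (f a')) \<longleftrightarrow>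
    (\<exists>u \<in> filt B. \<forall>a \<in> carrier A. \<forall>a' \<in> carrier A. a \<sqsubseteq>\<^bsub>A\<^esub> a' \<longrightarrow> u \<in> D_arr B (f a) (f a'))" .
  show ?thesis
    unfolding OPCA_D_def OPCA_def D_pca_simps mem_Collect_eq 1 2 ..
next
  case False
  then show ?thesis by (simp add: OPCA_D_def OPCA_def)
qed

lemma OPCA_D_downset: "f \<in> OPCA_D A B \<Longrightarrow> a \<in> carrier A \<Longrightarrow> f a \<in> downsets B"
  by (auto simp: OPCA_D_iff)

lemma OPCA_D_le_iff:
  assumes "f \<in> carrier A \<rightarrow> downsets B" "f' \<in> carrier A \<rightarrow> downsets B"
  shows "OPCA_D_le A B f f' \<longleftrightarrow> (\<exists>s \<in> filt B. \<forall>a \<in> carrier A. s \<in> D_arr B (f a) (f' a))"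
proof -
  have e: "def_le (D_pca B) (D_app B \<tau> (f a)) (f' a) \<longleftrightarrow> \<tau> \<subseteq> D_arr B (f a) (f' a)"
    if "\<tau> \<in> D_filt B" "a \<in> carrier A" for \<tau> a
    using that assms by (intro B.def_le_D_app_iff downsets_subset) (auto simp: D_filt_iff)
  have "OPCA_D_le A B f f' \<longleftrightarrow> (\<exists>\<tau> \<in> D_filt B. \<forall>a. a \<in> carrier A \<longrightarrow> \<tau> \<subseteq> D_arr B (f a) (f' a))"
    unfolding OPCA_D_le_def OPCA_le_def D_pca_simps
    using e by (intro bex_cong[OF refl]) auto
  also have "\<dots> \<longleftrightarrow> (\<exists>s \<in> filt B. \<forall>a. a \<in> carrier A \<longrightarrow> s \<in> D_arr B (f a) (f' a))"
    by (rule B.ex_D_filt_iff) (use assms in \<open>auto intro!: B.arr_downset\<close>)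
  finally show ?thesis by auto
qed

lemma ArrAlg_le_iff:
  assumes "F \<in> downsets A \<rightarrow> downsets B" "F' \<in> downsets A \<rightarrow> downsets B"
  shows "ArrAlg_le (D_alg A) (D_alg B) F F' \<longleftrightarrow>
    (\<exists>s \<in> filt B. \<forall>\<alpha> \<in> downsets A. s \<in> D_arr B (F \<alpha>) (F' \<alpha>))"
proof -
  have "{D_arr B (F \<alpha>) (F' \<alpha>) | \<alpha>. \<alpha> \<in> downsets A} \<subseteq> downsets B"
    using assms by (auto intro!: B.arr_downset)
  from B.inf_in_D_filt_iff[OF this] show ?thesis
    by (auto simp: ArrAlg_le_def)
qed

lemma ArrAlg_iff:
  "F \<in> ArrAlg (D_alg A) (D_alg B) \<longleftrightarrow>
     F \<in> downsets A \<rightarrow>\<^sub>E downsets B \<and> (\<forall>\<alpha> \<in> D_filt A. F \<alpha> \<in> D_filt B) \<and>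
     (\<exists>e \<in> filt B. \<forall>\<alpha> \<in> downsets A. \<forall>\<alpha>' \<in> downsets A.
        e \<in> D_arr B (F (D_arr A \<alpha> \<alpha>')) (D_arr B (F \<alpha>) (F \<alpha>'))) \<and>
     (\<forall>X \<subseteq> downsets A \<times> downsets A.
        (\<exists>e \<in> filt A. \<forall>(\<alpha>, \<alpha>') \<in> X. e \<in> D_arr A \<alpha> \<alpha>') \<longrightarrow>
        (\<exists>e \<in> filt B. \<forall>(\<alpha>, \<alpha>') \<in> X. e \<in> D_arr B (F \<alpha>) (F \<alpha>')))"
proof (cases "F \<in> downsets A \<rightarrow>\<^sub>E downsets B")
  case True
  have d: "F \<alpha> \<in> downsets B" if "\<alpha> \<in> downsets A" for \<alpha>
    using True that by blast
  let ?Q = "\<lambda>(\<alpha>, \<alpha>'). \<alpha> \<in> downsets A \<and> \<alpha>' \<in> downsets A"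
  let ?S = "\<lambda>(\<alpha>, \<alpha>'). D_arr B (F (D_arr A \<alpha> \<alpha>')) (D_arr B (F \<alpha>) (F \<alpha>'))"
  have "(\<exists>\<tau> \<in> D_filt B. \<forall>\<alpha> \<in> downsets A. \<forall>\<alpha>' \<in> downsets A.
        \<tau> \<subseteq> D_arr B (F (D_arr A \<alpha> \<alpha>')) (D_arr B (F \<alpha>) (F \<alpha>'))) \<longleftrightarrow>
      (\<exists>\<tau> \<in> D_filt B. \<forall>i. ?Q i \<longrightarrow> \<tau> \<subseteq> ?S i)"
    by (rule bex_cong[OF refl]) auto
  also have "\<dots> \<longleftrightarrow> (\<exists>t \<in> filt B. \<forall>i. ?Q i \<longrightarrow> t \<in> ?S i)"
    by (rule B.ex_D_filt_iff) (use d in auto)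
  also have "\<dots> \<longleftrightarrow> (\<exists>e \<in> filt B. \<forall>\<alpha> \<in> downsets A. \<forall>\<alpha>' \<in> downsets A.
        e \<in> D_arr B (F (D_arr A \<alpha> \<alpha>')) (D_arr B (F \<alpha>) (F \<alpha>')))"
    by (rule bex_cong[OF refl]) auto
  finally have 1: "(\<exists>\<tau> \<in> D_filt B. \<forall>\<alpha> \<in> downsets A. \<forall>\<alpha>' \<in> downsets A.
        \<tau> \<subseteq> D_arr B (F (D_arr A \<alpha> \<alpha>')) (D_arr B (F \<alpha>) (F \<alpha>'))) \<longleftrightarrow>
      (\<exists>e \<in> filt B. \<forall>\<alpha> \<in> downsets A. \<forall>\<alpha>' \<in> downsets A.
        e \<in> D_arr B (F (D_arr A \<alpha> \<alpha>')) (D_arr B (F \<alpha>) (F \<alpha>')))" .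
  have 2: "\<Sqinter>\<^bsub>D_alg A\<^esub>{D_arr A \<alpha> \<alpha>' | \<alpha> \<alpha>'. (\<alpha>, \<alpha>') \<in> X} \<in> D_filt A \<longleftrightarrow>
      (\<exists>e \<in> filt A. \<forall>(\<alpha>, \<alpha>') \<in> X. e \<in> D_arr A \<alpha> \<alpha>')"
    if "X \<subseteq> downsets A \<times> downsets A" for X
  proof -
    have "{D_arr A \<alpha> \<alpha>' | \<alpha> \<alpha>'. (\<alpha>, \<alpha>') \<in> X} \<subseteq> downsets A"
      using that by auto
    from A.inf_in_D_filt_iff[OF this] show ?thesis by auto
  qed
  have 3: "\<Sqinter>\<^bsub>D_alg B\<^esub>{D_arr B (F \<alpha>) (F \<alpha>') | \<alpha> \<alpha>'. (\<alpha>, \<alpha>') \<in> X} \<in> D_filt B \<longleftrightarrow>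
      (\<exists>e \<in> filt B. \<forall>(\<alpha>, \<alpha>') \<in> X. e \<in> D_arr B (F \<alpha>) (F \<alpha>'))"
    if "X \<subseteq> downsets A \<times> downsets A" for X
  proof -
    have "{D_arr B (F \<alpha>) (F \<alpha>') | \<alpha> \<alpha>'. (\<alpha>, \<alpha>') \<in> X} \<subseteq> downsets B"
      using that d by auto
    from B.inf_in_D_filt_iff[OF this] show ?thesis by auto
  qed
  show ?thesis
    unfolding ArrAlg_def D_alg_simps mem_Collect_eq 1
    by (intro conj_cong refl all_cong imp_cong) (use 2 3 in auto)
next
  case False
  then show ?thesis by (simp add: ArrAlg_def)
qed

lemma ArrAlg_downset: "F \<in> ArrAlg (D_alg A) (D_alg B) \<Longrightarrow> \<alpha> \<in> downsets A \<Longrightarrow> F \<alpha> \<in> downsets B"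
  by (auto simp: ArrAlg_iff)

text \<open>
  Quantifying over all downsets \<open>\<gamma>\<close> that contain \<open>s\<cdot>f a\<close>, instead of mentioning this set itself,
  removes all partial operations on subsets from the definition of density.
\<close>

lemma OPCA_D_cd_iff:
  "f \<in> OPCA_D_cd A B \<longleftrightarrow> f \<in> OPCA_D A B \<and>
    (\<exists>m \<in> filt B. \<forall>s \<in> filt B. \<exists>r \<in> filt A. \<forall>a \<in> carrier A. \<forall>\<gamma> \<in> downsets B.
       s \<in> D_arr B (f a) \<gamma> \<longrightarrow> value_in (app A r a) {a' \<in> carrier A. m \<in> D_arr B (f a') \<gamma>})"
proof (cases "f \<in> OPCA_D A B")
  case True
  note d = OPCA_D_downset[OF True]
  have "(\<forall>\<gamma>. elem_app B s (f a) = Some \<gamma> \<longrightarrow>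
       (\<exists>a' \<gamma>'. app A r a = Some a' \<and> elem_app B m (f a') = Some \<gamma>' \<and> \<gamma>' \<subseteq> \<gamma>)) \<longleftrightarrow>
    (\<forall>\<gamma> \<in> downsets B.
       s \<in> D_arr B (f a) \<gamma> \<longrightarrow> value_in (app A r a) {a' \<in> carrier A. m \<in> D_arr B (f a') \<gamma>})"
    (is "?L \<longleftrightarrow> ?R")
    if "m \<in> filt B" "s \<in> filt B" "r \<in> filt A" "a \<in> carrier A" for m s r a
  proof -
    have m: "m \<in> carrier B" and s: "s \<in> carrier B" and r: "r \<in> carrier A"
      using that A.filt_subset B.filt_subset by auto
    have c: "a' \<in> carrier A" if "app A r a = Some a'" for a'
      by (rule A.app_closed[OF r \<open>a \<in> carrier A\<close> that])
    note e = B.elem_app_le_iff[OF _ downsets_subset[OF d]]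
    show ?thesis
    proof
      assume L: ?L
      show ?R
      proof (intro ballI impI)
        fix \<gamma> assume \<gamma>: "\<gamma> \<in> downsets B" "s \<in> D_arr B (f a) \<gamma>"
        then obtain \<delta> where "elem_app B s (f a) = Some \<delta>" "\<delta> \<subseteq> \<gamma>"
          using e[OF s \<open>a \<in> carrier A\<close> \<gamma>(1)] by blast
        then obtain a' \<gamma>' where a': "app A r a = Some a'" "elem_app B m (f a') = Some \<gamma>'" "\<gamma>' \<subseteq> \<gamma>"
          using L by blast
        then show "value_in (app A r a) {a' \<in> carrier A. m \<in> D_arr B (f a') \<gamma>}"
          using e[OF m c \<gamma>(1)] c by auto
      qed
    next
      assume R: ?R
      show ?L
      proof (intro allI impI)
        fix \<gamma> assume \<gamma>: "elem_app B s (f a) = Some \<gamma>"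
        have \<gamma>': "\<gamma> \<in> downsets B"
          by (rule B.elem_app_downset[OF s downsets_subset[OF d[OF \<open>a \<in> carrier A\<close>]] \<gamma>])
        then have "s \<in> D_arr B (f a) \<gamma>"
          using e[OF s \<open>a \<in> carrier A\<close> \<gamma>'] \<gamma> by auto
        then have "value_in (app A r a) {a' \<in> carrier A. m \<in> D_arr B (f a') \<gamma>}"
          using R \<gamma>' by blast
        then obtain a' where a': "app A r a = Some a'" "m \<in> D_arr B (f a') \<gamma>"
          by (auto simp: value_in_def)
        then show "\<exists>a' \<gamma>'. app A r a = Some a' \<and> elem_app B m (f a') = Some \<gamma>' \<and> \<gamma>' \<subseteq> \<gamma>"
          using e[OF m c[OF a'(1)] \<gamma>'] by auto
      qed
    qed
  qed
  then show ?thesis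
    unfolding OPCA_D_cd_def mem_Collect_eq by (intro conj_cong bex_cong ball_cong refl) auto
next
  case False
  then show ?thesis by (simp add: OPCA_D_cd_def)
qed

end

section \<open>Functoriality\<close>

lemma (in pca) filtD: "a \<in> filt P \<Longrightarrow> a \<in> carrier P"
  using filt_subset by blast

lemma D_tilde_app: "\<alpha> \<in> downsets A \<Longrightarrow> D_tilde A f \<alpha> = (\<Union>a \<in> \<alpha>. f a)"
  by (simp add: D_tilde_def)

lemma Union_downset: "(\<And>i. i \<in> I \<Longrightarrow> S i \<in> downsets P) \<Longrightarrow> (\<Union>i \<in> I. S i) \<in> downsets P"
  unfolding downsets_def by blast

context pca_pair
begin

lemma OPCA_DI:
  assumes "f \<in> carrier A \<rightarrow>\<^sub>E downsets B" "\<And>a. a \<in> filt A \<Longrightarrow> f a \<in> D_filt B"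
    and "t \<in> filt B" "\<And>a a' c. a \<in> carrier A \<Longrightarrow> a' \<in> carrier A \<Longrightarrow> app A a a' = Some c \<Longrightarrow>
        t \<in> D_arr B (f a) (D_arr B (f a') (f c))"
    and "u \<in> filt B" "\<And>a a'. a \<in> carrier A \<Longrightarrow> a' \<in> carrier A \<Longrightarrow> a \<sqsubseteq>\<^bsub>A\<^esub> a' \<Longrightarrow>
        u \<in> D_arr B (f a) (f a')"
  shows "f \<in> OPCA_D A B"
  unfolding OPCA_D_iff
  by (intro conjI ballI bexI[of _ t] bexI[of _ u] allI impI assms)

lemma ArrAlgI:
  assumes "F \<in> downsets A \<rightarrow>\<^sub>E downsets B" "\<And>\<alpha>. \<alpha> \<in> D_filt A \<Longrightarrow> F \<alpha> \<in> D_filt B"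
    and "e \<in> filt B" "\<And>\<alpha> \<alpha>'. \<alpha> \<in> downsets A \<Longrightarrow> \<alpha>' \<in> downsets A \<Longrightarrow>
        e \<in> D_arr B (F (D_arr A \<alpha> \<alpha>')) (D_arr B (F \<alpha>) (F \<alpha>'))"
    and "\<And>X. X \<subseteq> downsets A \<times> downsets A \<Longrightarrow> \<exists>e \<in> filt A. \<forall>(\<alpha>, \<alpha>') \<in> X. e \<in> D_arr A \<alpha> \<alpha>' \<Longrightarrow>
        \<exists>e \<in> filt B. \<forall>(\<alpha>, \<alpha>') \<in> X. e \<in> D_arr B (F \<alpha>) (F \<alpha>')"
  shows "F \<in> ArrAlg (D_alg A) (D_alg B)"
  unfolding ArrAlg_iff
  by (intro conjI ballI bexI[of _ e] allI impI assms)

lemma D_tilde_downset: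
  assumes "f \<in> OPCA_D A B" "\<alpha> \<in> downsets A"
  shows "D_tilde A f \<alpha> \<in> downsets B"
  unfolding D_tilde_app[OF assms(2)]
  by (rule Union_downset) (use assms downsets_subset OPCA_D_downset in blast)

text \<open>
  An element \<open>x\<close> of \<open>f e\<close> acts on \<open>f a\<close> as \<open>e\<close> acts on \<open>a\<close>, through the tracker \<open>t\<close> of \<open>f\<close>: this
  gives compatibility with implication. Partially applied to one such \<open>x\<close> in the filter, the
  tracker turns a uniform realizer \<open>e\<close> of a family of implications into one for its image.
\<close>

lemma D_tilde_in_ArrAlg:
  assumes f: "f \<in> OPCA_D A B"
  shows "D_tilde A f \<in> ArrAlg (D_alg A) (D_alg B)"
proof -
  obtain t where t: "t \<in> filt B"
    and tr: "\<forall>a \<in> carrier A. \<forall>a' \<in> carrier A. \<forall>c. app A a a' = Some c \<longrightarrow>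
        t \<in> D_arr B (f a) (D_arr B (f a') (f c))"
    using f unfolding OPCA_D_iff by blast
  note d = D_tilde_downset[OF f]
  have mem: "\<exists>a \<in> \<alpha>. a \<in> carrier A \<and> x \<in> f a" if "\<alpha> \<in> downsets A" "x \<in> D_tilde A f \<alpha>" for \<alpha> x
    using that downsets_subset by (fastforce simp: D_tilde_app)
  have track: "value_in (Some t \<bullet>\<^bsub>B\<^esub> Some x \<bullet>\<^bsub>B\<^esub> Some y) (D_tilde A f \<alpha>')"
    if \<alpha>: "\<alpha> \<in> downsets A" "\<alpha>' \<in> downsets A" and e: "e \<in> D_arr A \<alpha> \<alpha>'" "x \<in> f e"
      and y: "y \<in> D_tilde A f \<alpha>" for \<alpha> \<alpha>' e x y
  proof -
    obtain a where a: "a \<in> \<alpha>" "a \<in> carrier A" "y \<in> f a"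
      using mem \<alpha> y by blast
    then obtain c where c: "app A e a = Some c" "c \<in> \<alpha>'"
      using e(1) by (auto simp: D_arr_def)
    have "e \<in> carrier A" using e(1) by (simp add: D_arr_iff)
    then have "t \<in> D_arr B (f e) (D_arr B (f a) (f c))"
      using tr a(2) c(1) by blast
    then have "value_in (Some t \<bullet>\<^bsub>B\<^esub> Some x \<bullet>\<^bsub>B\<^esub> Some y) (f c)"
      using e(2) a(3) by (intro value_in_papp[where \<alpha> = "f a"] value_in_papp[where \<alpha> = "f e"]) simp_all
    then show ?thesis
      by (rule value_in_mono) (use c(2) in \<open>auto simp: D_tilde_app[OF \<alpha>(2)]\<close>)
  qed
  \<comment> \<open>\<open>t\<close> itself may be undefined at elements of \<open>f e\<close> if \<open>e\<close> has no argument in \<open>\<alpha>\<close>, for instance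
    because \<open>\<alpha>\<close> is empty; hence the eta expansion\<close>
  let ?e = "B.lambda2 (App (App (Con t) (Var 0)) (Var 1))"
  have 1: "?e \<in> filt B"
    using t by (intro B.lambda2_filt) simp
  have 2: "?e \<in> D_arr B (D_tilde A f (D_arr A \<alpha> \<alpha>')) (D_arr B (D_tilde A f \<alpha>) (D_tilde A f \<alpha>'))"
    if \<alpha>: "\<alpha> \<in> downsets A" "\<alpha>' \<in> downsets A" for \<alpha> \<alpha>'
  proof (rule B.lambda2_in)
    have D: "D_arr A \<alpha> \<alpha>' \<in> downsets A" using \<alpha> by simp
    fix \<rho> :: "nat \<Rightarrow> 'b"
    assume \<rho>: "\<rho> 0 \<in> D_tilde A f (D_arr A \<alpha> \<alpha>')" "\<rho> 1 \<in> D_tilde A f \<alpha>"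
    then obtain e where "e \<in> D_arr A \<alpha> \<alpha>'" "\<rho> 0 \<in> f e"
      using mem[OF D] by blast
    then show "value_in (eval B \<rho> (App (App (Con t) (Var 0)) (Var 1))) (D_tilde A f \<alpha>')"
      unfolding eval.simps by (rule track[OF \<alpha> _ _ \<rho>(2)])
  qed (use t \<alpha> d in auto)
  have 3: "\<exists>e \<in> filt B. \<forall>(\<alpha>, \<alpha>') \<in> X. e \<in> D_arr B (D_tilde A f \<alpha>) (D_tilde A f \<alpha>')"
    if X: "X \<subseteq> downsets A \<times> downsets A" and ex: "\<exists>e \<in> filt A. \<forall>(\<alpha>, \<alpha>') \<in> X. e \<in> D_arr A \<alpha> \<alpha>'" for X
  proof -
    obtain e where e: "e \<in> filt A" "\<forall>(\<alpha>, \<alpha>') \<in> X. e \<in> D_arr A \<alpha> \<alpha>'" using ex by blast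
    have "f e \<in> D_filt B" using f e(1) unfolding OPCA_D_iff by blast
    then obtain x where x: "x \<in> filt B" "x \<in> f e" by (auto simp: D_filt_iff)
    let ?r = "B.lambda1 (App (App (Con t) (Con x)) (Var 0))"
    have "?r \<in> filt B"
      using t x by (intro B.lambda1_filt) simp
    moreover have "?r \<in> D_arr B (D_tilde A f \<alpha>) (D_tilde A f \<alpha>')" if "(\<alpha>, \<alpha>') \<in> X" for \<alpha> \<alpha>'
    proof (rule B.lambda1_in)
      have \<alpha>: "\<alpha> \<in> downsets A" "\<alpha>' \<in> downsets A" "e \<in> D_arr A \<alpha> \<alpha>'" using that X e by auto
      then show "D_tilde A f \<alpha> \<in> downsets B" "D_tilde A f \<alpha>' \<in> downsets B" using d by auto
      fix \<rho> :: "nat \<Rightarrow> 'b"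
      assume \<rho>: "\<rho> 0 \<in> D_tilde A f \<alpha>"
      then show "value_in (eval B \<rho> (App (App (Con t) (Con x)) (Var 0))) (D_tilde A f \<alpha>')"
        unfolding eval.simps by (rule track[OF \<alpha> x(2)])
    qed (use t x in auto)
    ultimately show ?thesis by blast
  qed
  have 4: "D_tilde A f \<alpha> \<in> D_filt B" if \<alpha>: "\<alpha> \<in> D_filt A" for \<alpha>
  proof -
    obtain a where a: "\<alpha> \<in> downsets A" "a \<in> filt A" "a \<in> \<alpha>" using \<alpha> by (auto simp: D_filt_iff)
    have "f a \<in> D_filt B" using f a(2) unfolding OPCA_D_iff by blast
    then show ?thesis
      using a d[OF a(1)] by (auto simp: D_filt_iff D_tilde_app)
  qed
  have 5: "D_tilde A f \<in> downsets A \<rightarrow>\<^sub>E downsets B"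
  proof (rule PiE_I)
    show "D_tilde A f \<alpha> = undefined" if "\<alpha> \<notin> downsets A" for \<alpha>
      using that by (simp add: D_tilde_def)
  qed (rule d)
  show ?thesis
    by (rule ArrAlgI[OF 5 4 1 2 3])
qed

lemma OPCA_D_mono:
  assumes "f \<in> OPCA_D A B"
  shows "\<exists>u \<in> filt B. \<forall>a \<in> carrier A. \<forall>a' \<in> carrier A. a \<sqsubseteq>\<^bsub>A\<^esub> a' \<longrightarrow> u \<in> D_arr B (f a) (f a')"
  using assms unfolding OPCA_D_iff by blast

text \<open>
  A realizer of \<open>f \<le> f'\<close> realizes \<open>f~ \<turnstile> f'~\<close> as well, because unions are computed elementwise. For the
  converse, evaluate at \<open>\<down>a\<close>: there \<open>f~\<close> contains \<open>f a\<close>, and the values of \<open>f'~\<close> are returned to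
  \<open>f' a\<close> by the realizer \<open>u\<close> of monotonicity of \<open>f'\<close>.
\<close>

lemma D_tilde_le_iff:
  assumes f: "f \<in> OPCA_D A B" and f': "f' \<in> OPCA_D A B"
  shows "ArrAlg_le (D_alg A) (D_alg B) (D_tilde A f) (D_tilde A f') \<longleftrightarrow> OPCA_D_le A B f f'"
proof -
  note d = OPCA_D_downset[OF f] OPCA_D_downset[OF f']
  have maps: "f \<in> carrier A \<rightarrow> downsets B" "f' \<in> carrier A \<rightarrow> downsets B"
    "D_tilde A f \<in> downsets A \<rightarrow> downsets B" "D_tilde A f' \<in> downsets A \<rightarrow> downsets B"
    using d D_tilde_downset f f' by auto
  show ?thesis
    unfolding OPCA_D_le_iff[OF maps(1,2)] ArrAlg_le_iff[OF maps(3,4)]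
  proof
    assume "\<exists>s \<in> filt B. \<forall>a \<in> carrier A. s \<in> D_arr B (f a) (f' a)"
    then obtain s where s: "s \<in> filt B" "\<forall>a \<in> carrier A. s \<in> D_arr B (f a) (f' a)" by blast
    have "s \<in> D_arr B (D_tilde A f \<alpha>) (D_tilde A f' \<alpha>)" if \<alpha>: "\<alpha> \<in> downsets A" for \<alpha>
      unfolding D_arr_iff
    proof (intro conjI ballI)
      fix x assume "x \<in> D_tilde A f \<alpha>"
      then obtain a where a: "a \<in> \<alpha>" "x \<in> f a" by (auto simp: D_tilde_app[OF \<alpha>])
      then have "s \<in> D_arr B (f a) (f' a)"
        using s(2) downsets_subset[OF \<alpha>] by blast
      then have "value_in (app B s x) (f' a)" using a(2) by (rule value_in_app)
      then show "value_in (app B s x) (D_tilde A f' \<alpha>)"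
        by (rule value_in_mono) (use a(1) in \<open>auto simp: D_tilde_app[OF \<alpha>]\<close>)
    qed (rule B.filtD[OF s(1)])
    then show "\<exists>s \<in> filt B. \<forall>\<alpha> \<in> downsets A. s \<in> D_arr B (D_tilde A f \<alpha>) (D_tilde A f' \<alpha>)"
      using s(1) by blast
  next
    assume "\<exists>s \<in> filt B. \<forall>\<alpha> \<in> downsets A. s \<in> D_arr B (D_tilde A f \<alpha>) (D_tilde A f' \<alpha>)"
    then obtain s where s: "s \<in> filt B"
      and sr: "\<forall>\<alpha> \<in> downsets A. s \<in> D_arr B (D_tilde A f \<alpha>) (D_tilde A f' \<alpha>)" by blast
    obtain u where u: "u \<in> filt B"
      and ur: "\<forall>a \<in> carrier A. \<forall>a' \<in> carrier A. a \<sqsubseteq>\<^bsub>A\<^esub> a' \<longrightarrow> u \<in> D_arr B (f' a) (f' a')"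
      using OPCA_D_mono[OF f'] by blast
    let ?e = "B.lambda1 (App (Con u) (App (Con s) (Var 0)))"
    have "?e \<in> D_arr B (f a) (f' a)" if a: "a \<in> carrier A" for a
    proof (rule B.lambda1_in)
      fix \<rho> :: "nat \<Rightarrow> 'b" assume \<rho>: "\<rho> 0 \<in> f a"
      have da: "down A a \<in> downsets A" using a by simp
      have "s \<in> D_arr B (D_tilde A f (down A a)) (D_tilde A f' (down A a))"
        using sr da by blast
      moreover have "\<rho> 0 \<in> D_tilde A f (down A a)"
        using \<rho> a A.down_self[OF a] by (auto simp: D_tilde_app[OF da])
      moreover have "u \<in> D_arr B (D_tilde A f' (down A a)) (f' a)"
        unfolding D_tilde_app[OF da] using ur a B.filtD[OF u] by (auto simp: D_arr_iff down_def)
      ultimately show "value_in (eval B \<rho> (App (Con u) (App (Con s) (Var 0)))) (f' a)"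
        unfolding eval.simps by (intro value_in_papp[where \<alpha> = "D_tilde A f' (down A a)"]
            value_in_papp[where \<alpha> = "D_tilde A f (down A a)"]) simp_all
    qed (use d a s u in auto)
    moreover have "?e \<in> filt B"
      using s u by (intro B.lambda1_filt) simp
    ultimately show "\<exists>s \<in> filt B. \<forall>a \<in> carrier A. s \<in> D_arr B (f a) (f' a)" by blast
  qed
qed

lemma ArrAlg_le_trans:
  assumes F: "F \<in> downsets A \<rightarrow> downsets B" "F' \<in> downsets A \<rightarrow> downsets B" "F'' \<in> downsets A \<rightarrow> downsets B"
    and le: "ArrAlg_le (D_alg A) (D_alg B) F F'" "ArrAlg_le (D_alg A) (D_alg B) F' F''"
  shows "ArrAlg_le (D_alg A) (D_alg B) F F''"
proof -
  have d: "\<And>\<alpha>. \<alpha> \<in> downsets A \<Longrightarrow> F \<alpha> \<in> downsets B" "\<And>\<alpha>. \<alpha> \<in> downsets A \<Longrightarrow> F' \<alpha> \<in> downsets B"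
    "\<And>\<alpha>. \<alpha> \<in> downsets A \<Longrightarrow> F'' \<alpha> \<in> downsets B"
    using F by auto
  obtain s where s: "s \<in> filt B" "\<forall>\<alpha> \<in> downsets A. s \<in> D_arr B (F \<alpha>) (F' \<alpha>)"
    using le(1) ArrAlg_le_iff[OF F(1,2)] by blast
  obtain t where t: "t \<in> filt B" "\<forall>\<alpha> \<in> downsets A. t \<in> D_arr B (F' \<alpha>) (F'' \<alpha>)"
    using le(2) ArrAlg_le_iff[OF F(2,3)] by blast
  let ?e = "B.lambda1 (App (Con t) (App (Con s) (Var 0)))"
  have "?e \<in> D_arr B (F \<alpha>) (F'' \<alpha>)" if "\<alpha> \<in> downsets A" for \<alpha>
  proof (rule B.lambda1_in)
    fix \<rho> :: "nat \<Rightarrow> 'b" assume "\<rho> 0 \<in> F \<alpha>"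
    then show "value_in (eval B \<rho> (App (Con t) (App (Con s) (Var 0)))) (F'' \<alpha>)"
      unfolding eval.simps using s t that
      by (intro value_in_papp[where \<alpha> = "F' \<alpha>"] value_in_papp[where \<alpha> = "F \<alpha>"]) simp_all
  qed (use d that s t in auto)
  moreover have "?e \<in> filt B"
    using s t by (intro B.lambda1_filt) simp
  ultimately have "\<exists>s \<in> filt B. \<forall>\<alpha> \<in> downsets A. s \<in> D_arr B (F \<alpha>) (F'' \<alpha>)" by blast
  then show ?thesis
    using ArrAlg_le_iff[OF F(1,3)] by blast
qed

lemma ArrAlg_le_refl:
  assumes "F \<in> downsets A \<rightarrow> downsets B"
  shows "ArrAlg_le (D_alg A) (D_alg B) F F"
proof -
  have d: "\<And>\<alpha>. \<alpha> \<in> downsets A \<Longrightarrow> F \<alpha> \<in> downsets B" using assms by auto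
  have "\<forall>\<alpha> \<in> downsets A. B.lambda1 (Var 0) \<in> D_arr B (F \<alpha>) (F \<alpha>)"
    using B.id_in d by blast
  moreover have "B.lambda1 (Var 0) \<in> filt B"
    by (rule B.lambda1_filt) simp
  ultimately have "\<exists>s \<in> filt B. \<forall>\<alpha> \<in> downsets A. s \<in> D_arr B (F \<alpha>) (F \<alpha>)" by blast
  then show ?thesis using ArrAlg_le_iff[OF assms assms] by blast
qed

end

lemma (in pca) OPCA_D_id_closed: "OPCA_D_id P \<in> OPCA_D P P"
proof -
  interpret pca_pair P P by unfold_locales
  let ?i = "OPCA_D_id P"
  have i: "?i a = down P a" if "a \<in> carrier P" for a
    using that by (simp add: OPCA_D_id_def down_def)
  let ?t = "App (Var 0) (Var 1)"
  show ?thesis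
  proof (rule OPCA_DI)
    show "lambda2 ?t \<in> filt P" by (rule lambda2_filt) simp
    show "lambda1 (Var 0) \<in> filt P" by (rule lambda1_filt) simp
    show "?i \<in> carrier P \<rightarrow>\<^sub>E downsets P"
      using down_downset i by (auto simp: OPCA_D_id_def)
    show "?i a \<in> D_filt P" if "a \<in> filt P" for a
      using that filtD[OF that] i by (auto simp: D_filt_iff intro!: bexI[of _ a])
    show "lambda1 (Var 0) \<in> D_arr P (?i a) (?i a')"
      if "a \<in> carrier P" "a' \<in> carrier P" "a \<sqsubseteq> a'" for a a'
      unfolding i[OF that(1)] i[OF that(2)] using that by (intro id_in down_mono) auto
    show "lambda2 ?t \<in> D_arr P (?i a) (D_arr P (?i a') (?i c))"
      if a: "a \<in> carrier P" "a' \<in> carrier P" and c: "app P a a' = Some c" for a a' c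
    proof -
      have cc: "c \<in> carrier P" by (rule app_closed[OF a c])
      show ?thesis unfolding i[OF a(1)] i[OF a(2)] i[OF cc]
      proof (rule lambda2_in)
        fix \<rho> :: "nat \<Rightarrow> 'a" assume \<rho>: "\<rho> 0 \<in> down P a" "\<rho> 1 \<in> down P a'"
        then have le: "def_le P (app P (\<rho> 0) (\<rho> 1)) c"
          using app_mono[of "\<rho> 0" a "\<rho> 1" a' c] a c by (simp add: down_def)
        have "value_in (app P (\<rho> 0) (\<rho> 1)) (down P c)"
        proof (rule value_in_def_le[OF le])
          show "x \<in> carrier P" if "app P (\<rho> 0) (\<rho> 1) = Some x" for x
            by (rule app_closed[OF _ _ that]) (use \<rho> in \<open>auto simp: down_def\<close>)
        qed (use cc in auto)
        then show "value_in (eval P \<rho> ?t) (down P c)" by simp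
      qed (use a cc in auto)
    qed
  qed
qed

lemma (in pca) OPCA_D_id_cd: "OPCA_D_id P \<in> OPCA_D_cd P P"
proof -
  interpret pca_pair P P by unfold_locales
  let ?i = "OPCA_D_id P"
  have i: "?i a = down P a" if "a \<in> carrier P" for a
    using that by (simp add: OPCA_D_id_def down_def)
  have "value_in (app P s a) {a' \<in> carrier P. lambda1 (Var 0) \<in> D_arr P (?i a') \<gamma>}"
    if s: "s \<in> filt P" and a: "a \<in> carrier P" and \<gamma>: "\<gamma> \<in> downsets P" and sa: "s \<in> D_arr P (?i a) \<gamma>" for s a \<gamma>
  proof -
    have "value_in (app P s a) \<gamma>"
      by (rule value_in_app[OF sa]) (simp add: i[OF a] a)
    moreover have "\<gamma> \<subseteq> {a' \<in> carrier P. lambda1 (Var 0) \<in> D_arr P (?i a') \<gamma>}"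
    proof
      fix x assume x: "x \<in> \<gamma>"
      then have xc: "x \<in> carrier P" using downsets_subset[OF \<gamma>] by blast
      then show "x \<in> {a' \<in> carrier P. lambda1 (Var 0) \<in> D_arr P (?i a') \<gamma>}"
        using id_in[OF down_downset[OF xc] \<gamma> down_subset[OF x \<gamma>]] i[OF xc] by simp
    qed
    ultimately show ?thesis by (rule value_in_mono)
  qed
  moreover have "lambda1 (Var 0) \<in> filt P" by (rule lambda1_filt) simp
  ultimately show ?thesis unfolding OPCA_D_cd_iff using OPCA_D_id_closed by blast
qed

lemma D_tilde_id: "D_tilde A (OPCA_D_id A) = ArrAlg_id (D_alg A)" if "pca A"
proof -
  interpret pca A by fact
  have "(\<Union>a \<in> \<alpha>. OPCA_D_id A a) = \<alpha>" if \<alpha>: "\<alpha> \<in> downsets A" for \<alpha>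
  proof -
    have "(\<Union>a \<in> \<alpha>. OPCA_D_id A a) = (\<Union>a \<in> \<alpha>. down A a)"
      using downsets_subset[OF \<alpha>] by (intro SUP_cong) (auto simp: OPCA_D_id_def down_def)
    also have "\<dots> = \<alpha>"
    proof
      show "(\<Union>a \<in> \<alpha>. down A a) \<subseteq> \<alpha>" using down_subset[OF _ \<alpha>] by blast
      show "\<alpha> \<subseteq> (\<Union>a \<in> \<alpha>. down A a)" using downsets_subset[OF \<alpha>] by (auto intro!: bexI down_self)
    qed
    finally show ?thesis .
  qed
  then show ?thesis
    by (auto simp: D_tilde_def ArrAlg_id_def intro!: restrict_ext)
qed

lemma D_tilde_comp:
  assumes "pca A" "pca B" "f \<in> OPCA_D A B"
  shows "D_tilde A (OPCA_D_comp A g f) = ArrAlg_comp (D_alg A) (D_tilde B g) (D_tilde A f)"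
proof -
  interpret pca_pair A B by (intro pca_pair.intro assms)
  have "(\<Union>a \<in> \<alpha>. OPCA_D_comp A g f a) = D_tilde B g (D_tilde A f \<alpha>)" if \<alpha>: "\<alpha> \<in> downsets A" for \<alpha>
  proof -
    have "(\<Union>a \<in> \<alpha>. OPCA_D_comp A g f a) = (\<Union>a \<in> \<alpha>. \<Union>b \<in> f a. g b)"
      using downsets_subset[OF \<alpha>] by (intro SUP_cong) (auto simp: OPCA_D_comp_def)
    also have "\<dots> = D_tilde B g (D_tilde A f \<alpha>)"
      using D_tilde_downset[OF assms(3) \<alpha>] by (simp add: D_tilde_app \<alpha>)
    finally show ?thesis .
  qed
  then show ?thesis
    by (auto simp: D_tilde_def[of A "OPCA_D_comp A g f"] ArrAlg_comp_def intro!: restrict_ext)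
qed

text \<open>
  If \<open>t\<close> tracks \<open>f\<close>, then a tracker of the composite first lets some \<open>p \<in> g t\<close> from the filter act,
  using the tracker of \<open>g\<close>, on its first argument and then lets the result act on the second. In the same
  way, an element of \<open>g u\<close> gives monotonicity.
\<close>

lemma OPCA_D_comp_closed:
  fixes A :: "('a, 'm) pca_scheme" and B :: "('b, 'n) pca_scheme" and C :: "('c, 'k) pca_scheme"
  assumes "pca A" "pca B" "pca C" and f: "f \<in> OPCA_D A B" and g: "g \<in> OPCA_D B C"
  shows "OPCA_D_comp A g f \<in> OPCA_D A C"
proof -
  interpret AB: pca_pair A B by (intro pca_pair.intro assms)
  interpret BC: pca_pair B C by (intro pca_pair.intro assms)
  interpret AC: pca_pair A C by (intro pca_pair.intro assms)
  let ?h = "OPCA_D_comp A g f"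
  have h: "?h a = (\<Union>b \<in> f a. g b)" if "a \<in> carrier A" for a
    using that by (simp add: OPCA_D_comp_def)
  have fB: "b \<in> carrier B" if "a \<in> carrier A" "b \<in> f a" for a b
    using AB.OPCA_D_downset[OF f that(1)] that(2) downsets_subset by blast
  have hd: "?h a \<in> downsets C" if "a \<in> carrier A" for a
    unfolding h[OF that] by (rule Union_downset) (rule BC.OPCA_D_downset[OF g fB[OF that]])
  obtain tf uf where tf: "tf \<in> filt B" and uf: "uf \<in> filt B"
    and tfr: "\<forall>a \<in> carrier A. \<forall>a' \<in> carrier A. \<forall>c. app A a a' = Some c \<longrightarrow>
        tf \<in> D_arr B (f a) (D_arr B (f a') (f c))"
    and ufr: "\<forall>a \<in> carrier A. \<forall>a' \<in> carrier A. a \<sqsubseteq>\<^bsub>A\<^esub> a' \<longrightarrow> uf \<in> D_arr B (f a) (f a')"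
    using f unfolding AB.OPCA_D_iff by blast
  obtain tg where tg: "tg \<in> filt C"
    and tgr: "\<forall>a \<in> carrier B. \<forall>a' \<in> carrier B. \<forall>c. app B a a' = Some c \<longrightarrow>
        tg \<in> D_arr C (g a) (D_arr C (g a') (g c))"
    using g unfolding BC.OPCA_D_iff by blast
  have gf: "g b \<in> D_filt C" if "b \<in> filt B" for b
    using g that unfolding BC.OPCA_D_iff by blast
  obtain p where p: "p \<in> filt C" "p \<in> g tf" using gf[OF tf] by (auto simp: D_filt_iff)
  obtain q where q: "q \<in> filt C" "q \<in> g uf" using gf[OF uf] by (auto simp: D_filt_iff)
  have track: "value_in (Some tg \<bullet>\<^bsub>C\<^esub> Some x \<bullet>\<^bsub>C\<^esub> Some y) (g v)"
    if "x \<in> g b" "y \<in> g b'" "app B b b' = Some v" "b \<in> carrier B" "b' \<in> carrier B" for x y b b' v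
    using that tgr by (intro value_in_papp[where \<alpha> = "g b'"] value_in_papp[where \<alpha> = "g b"]) simp_all
  let ?t = "App (App (Con tg) (App (App (Con tg) (Con p)) (Var 0))) (Var 1)"
  let ?u = "App (App (Con tg) (Con q)) (Var 0)"
  show ?thesis
  proof (rule AC.OPCA_DI)
    show "?h \<in> carrier A \<rightarrow>\<^sub>E downsets C"
      using hd by (auto simp: OPCA_D_comp_def)
    show "?h a \<in> D_filt C" if a: "a \<in> filt A" for a
    proof -
      have ac: "a \<in> carrier A" by (rule AB.A.filtD[OF a])
      have "f a \<in> D_filt B" using f a unfolding AB.OPCA_D_iff by blast
      then obtain b where b: "b \<in> filt B" "b \<in> f a" by (auto simp: D_filt_iff)
      obtain x where x: "x \<in> filt C" "x \<in> g b" using gf[OF b(1)] by (auto simp: D_filt_iff)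
      then have "x \<in> ?h a" using b h[OF ac] by blast
      then show ?thesis using x(1) hd[OF ac] unfolding D_filt_iff by blast
    qed
    show "BC.B.lambda2 ?t \<in> filt C"
      by (rule BC.B.lambda2_filt) (use tg p in simp)
    show "BC.B.lambda1 ?u \<in> filt C"
      by (rule BC.B.lambda1_filt) (use tg q in simp)
    show "BC.B.lambda2 ?t \<in> D_arr C (?h a) (D_arr C (?h a') (?h c))"
      if a: "a \<in> carrier A" "a' \<in> carrier A" and c: "app A a a' = Some c" for a a' c
    proof (rule BC.B.lambda2_in)
      have cc: "c \<in> carrier A" by (rule AB.A.app_closed[OF a c])
      then show "?h a \<in> downsets C" "?h a' \<in> downsets C" "?h c \<in> downsets C"
        using a hd by auto
      fix \<rho> :: "nat \<Rightarrow> 'c" assume "\<rho> 0 \<in> ?h a" "\<rho> 1 \<in> ?h a'"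
      then obtain b b' where b: "b \<in> f a" "\<rho> 0 \<in> g b" and b': "b' \<in> f a'" "\<rho> 1 \<in> g b'"
        using h a by auto
      have tfm: "tf \<in> D_arr B (f a) (D_arr B (f a') (f c))"
        using tfr a c by blast
      then obtain w where w: "app B tf b = Some w" "w \<in> D_arr B (f a') (f c)"
        using b(1) by (auto simp: D_arr_def)
      obtain v where v: "app B w b' = Some v" "v \<in> f c"
        using w(2) b'(1) by (auto simp: D_arr_def)
      have carr: "tf \<in> carrier B" "b \<in> carrier B" "b' \<in> carrier B" "w \<in> carrier B"
        using AB.B.filtD[OF tf] fB[OF a(1) b(1)] fB[OF a(2) b'(1)] w(2) by (auto simp: D_arr_iff)
      obtain z where z: "Some tg \<bullet>\<^bsub>C\<^esub> Some p \<bullet>\<^bsub>C\<^esub> Some (\<rho> 0) = Some z" "z \<in> g w"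
        using track[OF p(2) b(2) w(1) carr(1,2)] unfolding value_in_def by blast
      have "value_in (eval C \<rho> ?t) (g v)"
        unfolding eval.simps z(1) by (rule track[OF z(2) b'(2) v(1) carr(4,3)])
      then show "value_in (eval C \<rho> ?t) (?h c)"
        by (rule value_in_mono) (use v(2) h[OF cc] in auto)
    qed (use tg p in auto)
    show "BC.B.lambda1 ?u \<in> D_arr C (?h a) (?h a')"
      if a: "a \<in> carrier A" "a' \<in> carrier A" and le: "a \<sqsubseteq>\<^bsub>A\<^esub> a'" for a a'
    proof (rule BC.B.lambda1_in)
      fix \<rho> :: "nat \<Rightarrow> 'c" assume "\<rho> 0 \<in> ?h a"
      then obtain b where b: "b \<in> f a" "\<rho> 0 \<in> g b" using h a by auto
      have "uf \<in> D_arr B (f a) (f a')" using ufr a le by blast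
      then obtain v where v: "app B uf b = Some v" "v \<in> f a'"
        using b(1) by (auto simp: D_arr_def)
      have "value_in (eval C \<rho> ?u) (g v)"
        unfolding eval.simps by (rule track[OF q(2) b(2) v(1) AB.B.filtD[OF uf] fB[OF a(1) b(1)]])
      then show "value_in (eval C \<rho> ?u) (?h a')"
        by (rule value_in_mono) (use v(2) h[OF a(2)] in auto)
    qed (use tg q hd a in auto)
  qed
qed

text \<open>
  Given \<open>s\<close>, density of \<open>g\<close> yields \<open>rB\<close>, and density of \<open>f\<close>, applied to \<open>rB\<close>, yields \<open>rA\<close>. On
  \<open>g b\<close> with \<open>b \<in> f (rA a)\<close>, the witness \<open>?M\<close> first applies \<open>mf\<close> inside \<open>g\<close>, through \<open>n \<in> g mf\<close>,
  and then \<open>mg\<close>; it depends on the two witnesses only.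
\<close>

lemma OPCA_D_cd_comp_closed:
  fixes A :: "('a, 'm) pca_scheme" and B :: "('b, 'n) pca_scheme" and C :: "('c, 'k) pca_scheme"
  assumes "pca A" "pca B" "pca C" and f: "f \<in> OPCA_D_cd A B" and g: "g \<in> OPCA_D_cd B C"
  shows "OPCA_D_comp A g f \<in> OPCA_D_cd A C"
proof -
  interpret AB: pca_pair A B by (intro pca_pair.intro assms)
  interpret BC: pca_pair B C by (intro pca_pair.intro assms)
  interpret AC: pca_pair A C by (intro pca_pair.intro assms)
  let ?h = "OPCA_D_comp A g f"
  have h: "?h a = (\<Union>b \<in> f a. g b)" if "a \<in> carrier A" for a
    using that by (simp add: OPCA_D_comp_def)
  have f': "f \<in> OPCA_D A B" and g': "g \<in> OPCA_D B C"
    using f g by (simp_all add: OPCA_D_cd_def)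
  have fB: "b \<in> carrier B" if "a \<in> carrier A" "b \<in> f a" for a b
    using AB.OPCA_D_downset[OF f' that(1)] that(2) downsets_subset by blast
  have h': "?h \<in> OPCA_D A C" by (rule OPCA_D_comp_closed[OF assms(1-3) f' g'])
  obtain mf where mf: "mf \<in> filt B"
    and mfr: "\<forall>s \<in> filt B. \<exists>r \<in> filt A. \<forall>a \<in> carrier A. \<forall>\<gamma> \<in> downsets B.
       s \<in> D_arr B (f a) \<gamma> \<longrightarrow> value_in (app A r a) {a' \<in> carrier A. mf \<in> D_arr B (f a') \<gamma>}"
    using f unfolding AB.OPCA_D_cd_iff by blast
  obtain mg where mg: "mg \<in> filt C"
    and mgr: "\<forall>s \<in> filt C. \<exists>r \<in> filt B. \<forall>b \<in> carrier B. \<forall>\<gamma> \<in> downsets C.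
       s \<in> D_arr C (g b) \<gamma> \<longrightarrow> value_in (app B r b) {b' \<in> carrier B. mg \<in> D_arr C (g b') \<gamma>}"
    using g unfolding BC.OPCA_D_cd_iff by blast
  obtain tg ug where tg: "tg \<in> filt C" and ug: "ug \<in> filt C"
    and tgr: "\<forall>a \<in> carrier B. \<forall>a' \<in> carrier B. \<forall>c. app B a a' = Some c \<longrightarrow>
        tg \<in> D_arr C (g a) (D_arr C (g a') (g c))"
    and ugr: "\<forall>a \<in> carrier B. \<forall>a' \<in> carrier B. a \<sqsubseteq>\<^bsub>B\<^esub> a' \<longrightarrow> ug \<in> D_arr C (g a) (g a')"
    using g' unfolding BC.OPCA_D_iff by blast
  have "g mf \<in> D_filt C" using g' mf unfolding BC.OPCA_D_iff by blast
  then obtain n where n: "n \<in> filt C" "n \<in> g mf" by (auto simp: D_filt_iff)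
  let ?t = "App (Con mg) (App (Con ug) (App (App (Con tg) (Con n)) (Var 0)))"
  let ?M = "BC.B.lambda1 ?t"
  have M: "?M \<in> filt C"
    by (rule BC.B.lambda1_filt) (use mg ug tg n in simp)
  have "\<exists>r \<in> filt A. \<forall>a \<in> carrier A. \<forall>\<gamma> \<in> downsets C.
      s \<in> D_arr C (?h a) \<gamma> \<longrightarrow> value_in (app A r a) {a' \<in> carrier A. ?M \<in> D_arr C (?h a') \<gamma>}"
    if s: "s \<in> filt C" for s
  proof -
    obtain rB where rB: "rB \<in> filt B"
      and rBr: "\<forall>b \<in> carrier B. \<forall>\<gamma> \<in> downsets C.
       s \<in> D_arr C (g b) \<gamma> \<longrightarrow> value_in (app B rB b) {b' \<in> carrier B. mg \<in> D_arr C (g b') \<gamma>}"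
      using mgr s by blast
    obtain rA where rA: "rA \<in> filt A"
      and rAr: "\<forall>a \<in> carrier A. \<forall>\<gamma> \<in> downsets B.
       rB \<in> D_arr B (f a) \<gamma> \<longrightarrow> value_in (app A rA a) {a' \<in> carrier A. mf \<in> D_arr B (f a') \<gamma>}"
      using mfr rB by blast
    have "value_in (app A rA a) {a' \<in> carrier A. ?M \<in> D_arr C (?h a') \<gamma>}"
      if a: "a \<in> carrier A" and \<gamma>: "\<gamma> \<in> downsets C" and sa: "s \<in> D_arr C (?h a) \<gamma>" for a \<gamma>
    proof -
      \<comment> \<open>the elements \<open>b\<close> with \<open>mg \<in> g b \<rightarrow> \<gamma>\<close>, closed downwards since \<open>g\<close> preserves the order only
        up to the realizer \<open>ug\<close>\<close>
      define \<delta> where "\<delta> = (\<Union>b \<in> {b \<in> carrier B. mg \<in> D_arr C (g b) \<gamma>}. down B b)"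
      have \<delta>: "\<delta> \<in> downsets B"
        unfolding \<delta>_def by (rule Union_downset) simp
      have "{b \<in> carrier B. mg \<in> D_arr C (g b) \<gamma>} \<subseteq> \<delta>"
        unfolding \<delta>_def using AB.B.down_self by blast
      moreover have "value_in (app B rB b) {b \<in> carrier B. mg \<in> D_arr C (g b) \<gamma>}" if b: "b \<in> f a" for b
      proof -
        have "s \<in> D_arr C (g b) \<gamma>"
          using sa b unfolding h[OF a] D_arr_def by blast
        then show ?thesis using rBr fB[OF a b] \<gamma> by blast
      qed
      ultimately have "rB \<in> D_arr B (f a) \<delta>"
        unfolding D_arr_iff using AB.B.filtD[OF rB] value_in_mono by blast
      then have "value_in (app A rA a) {a' \<in> carrier A. mf \<in> D_arr B (f a') \<delta>}"
        using rAr a \<delta> by blast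
      moreover have "?M \<in> D_arr C (?h a') \<gamma>" if a': "a' \<in> carrier A" and mfa: "mf \<in> D_arr B (f a') \<delta>" for a'
      proof (rule BC.B.lambda1_in)
        fix \<rho> :: "nat \<Rightarrow> 'c" assume "\<rho> 0 \<in> ?h a'"
        then obtain b where b: "b \<in> f a'" "\<rho> 0 \<in> g b" using h[OF a'] by auto
        obtain v where v: "app B mf b = Some v" "v \<in> \<delta>"
          using mfa b(1) by (auto simp: D_arr_def)
        then obtain b' where b': "b' \<in> carrier B" "mg \<in> D_arr C (g b') \<gamma>" "v \<in> carrier B" "v \<sqsubseteq>\<^bsub>B\<^esub> b'"
          unfolding \<delta>_def by (auto simp: down_def)
        have 1: "tg \<in> D_arr C (g mf) (D_arr C (g b) (g v))"
          using tgr AB.B.filtD[OF mf] fB[OF a' b(1)] v(1) by blast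
        have 2: "ug \<in> D_arr C (g v) (g b')" using ugr b' by blast
        show "value_in (eval C \<rho> ?t) \<gamma>"
          unfolding eval.simps
          by (intro value_in_papp[where \<alpha> = "g b'"] value_in_papp[where \<alpha> = "g v"]
              value_in_papp[where \<alpha> = "g b"] value_in_papp[where \<alpha> = "g mf"] value_in_Some[THEN iffD2]
              1 2 b'(2) n(2) b(2))
      qed (use mg ug tg n AC.OPCA_D_downset[OF h' a'] \<gamma> in auto)
      ultimately show ?thesis
        by (elim value_in_mono) blast
    qed
    then show ?thesis using rA by blast
  qed
  then show ?thesis unfolding AC.OPCA_D_cd_iff using h' M by blast
qed

section \<open>Right adjoints from computational density\<close>

context pca
begin

text \<open>
  The Church pair \<open>\<lambda>z. z x y\<close>, kept as a term in the two variables 0 and 1 so that it can be part of larger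
  terms.
\<close>

definition pair_term :: "'a pterm" where
  "pair_term = abstraction 2 (App (App (Var 2) (Var 0)) (Var 1))"

definition fst_comb :: 'a where
  "fst_comb = lambda1 (App (Var 0) (Con (lambda2 (Var 0))))"

definition snd_comb :: 'a where
  "snd_comb = lambda1 (App (Var 0) (Con (lambda2 (Var 1))))"

lemma set_pair_term: "set_pterm pair_term \<subseteq> filt P"
  unfolding pair_term_def by (rule set_abstraction_filt) simp

lemma projection_filt: "lambda2 (Var i) \<in> filt P"
  by (rule lambda2_filt) simp

lemma fst_comb_filt: "fst_comb \<in> filt P" and snd_comb_filt: "snd_comb \<in> filt P"
  unfolding fst_comb_def snd_comb_def by (rule lambda1_filt, simp add: projection_filt)+

text \<open>
  A pair of \<open>x\<close> and \<open>y\<close> has every type \<open>(\<down>x \<rightarrow> \<down>y \<rightarrow> \<gamma>) \<rightarrow> \<gamma>\<close>; the projections use it at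
  \<open>\<gamma> = \<down>x\<close> and \<open>\<gamma> = \<down>y\<close>.
\<close>

lemma eval_pair_term:
  assumes \<rho>: "range \<rho> \<subseteq> carrier P"
  obtains c where "c \<in> carrier P" "eval P \<rho> pair_term = Some c"
    and "value_in (app P fst_comb c) (down P (\<rho> 0))" "value_in (app P snd_comb c) (down P (\<rho> 1))"
proof -
  have \<rho>': "\<rho> i \<in> carrier P" for i using \<rho> by blast
  let ?t = "App (App (Var 2) (Var 0)) (Var 1)"
  obtain c where c: "c \<in> carrier P" "eval P \<rho> pair_term = Some c"
    using abstraction_defined[OF _ \<rho>, of ?t 2] by (auto simp: pair_term_def)
  have proj: "value_in (app P (lambda1 (App (Var 0) (Con (lambda2 (Var j))))) c) (down P (\<rho> j))"
    if j: "j = 0 \<or> j = 1" for j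
  proof -
    let ?\<gamma> = "down P (\<rho> j)"
    let ?\<beta> = "D_arr P (down P (\<rho> 0)) (D_arr P (down P (\<rho> 1)) ?\<gamma>)"
    have \<beta>: "?\<beta> \<in> downsets P" and \<gamma>: "?\<gamma> \<in> downsets P" using \<rho>' by simp_all
    have "value_in (eval P \<rho> pair_term) (D_arr P ?\<beta> ?\<gamma>)"
      unfolding pair_term_def
    proof (rule value_in_abstraction[OF _ \<rho> downsets_subset[OF \<beta>] \<gamma>])
      fix x assume "x \<in> ?\<beta>"
      then show "value_in (eval P (\<rho>(2 := x)) ?t) ?\<gamma>"
        unfolding eval.simps using \<rho>'
        by (intro value_in_papp[where \<alpha> = "down P (\<rho> 1)"] value_in_papp[where \<alpha> = "down P (\<rho> 0)"])
          simp_all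
    qed simp
    then have cm: "c \<in> D_arr P ?\<beta> ?\<gamma>" using c by simp
    have "lambda2 (Var j) \<in> ?\<beta>"
      by (rule lambda2_in) (use j \<rho>' in auto)
    then have "value_in (app P c (lambda2 (Var j))) ?\<gamma>" by (rule value_in_app[OF cm])
    have "lambda1 (App (Var 0) (Con (lambda2 (Var j)))) \<in> D_arr P (D_arr P ?\<beta> ?\<gamma>) ?\<gamma>"
    proof (rule lambda1_in)
      fix \<sigma> :: "nat \<Rightarrow> 'a" assume "\<sigma> 0 \<in> D_arr P ?\<beta> ?\<gamma>"
      then show "value_in (eval P \<sigma> (App (Var 0) (Con (lambda2 (Var j))))) ?\<gamma>"
        unfolding eval.simps using \<open>lambda2 (Var j) \<in> ?\<beta>\<close> by (intro value_in_papp[where \<alpha> = ?\<beta>]) simp_all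
    qed (use projection_filt arr_downset[OF \<beta> \<gamma>] \<gamma> in auto)
    then show ?thesis using cm by (rule value_in_app)
  qed
  show ?thesis
    by (rule that[OF c]) (use proj[of 0] proj[of 1] in \<open>simp_all add: fst_comb_def snd_comb_def\<close>)
qed

end

text \<open>
  Quantifying over all \<open>a'\<close> below \<open>a\<close> makes the value a downset; the set of all \<open>a\<close> with
  \<open>m \<in> f a \<rightarrow> \<beta>\<close> need not be one, as \<open>f\<close> preserves the order only up to a realizer.
\<close>

definition right_adjoint ::
  "('a, 'm) pca_scheme \<Rightarrow> ('b, 'n) pca_scheme \<Rightarrow> ('a \<Rightarrow> 'b set) \<Rightarrow> 'b \<Rightarrow> 'b set \<Rightarrow> 'a set" where
  "right_adjoint A B f m = (\<lambda>\<beta> \<in> downsets B.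
     {a \<in> carrier A. \<forall>a' \<in> carrier A. a' \<sqsubseteq>\<^bsub>A\<^esub> a \<longrightarrow> m \<in> D_arr B (f a') \<beta>})"

context pca_pair
begin

lemma right_adjoint_iff:
  "\<beta> \<in> downsets B \<Longrightarrow> a \<in> right_adjoint A B f m \<beta> \<longleftrightarrow>
     a \<in> carrier A \<and> (\<forall>a' \<in> carrier A. a' \<sqsubseteq>\<^bsub>A\<^esub> a \<longrightarrow> m \<in> D_arr B (f a') \<beta>)"
  by (simp add: right_adjoint_def)

lemma right_adjoint_downset:
  assumes "\<beta> \<in> downsets B"
  shows "right_adjoint A B f m \<beta> \<in> downsets A"
  using assms A.le_trans unfolding downsets_def[of A] by (auto simp: right_adjoint_iff)

lemma right_adjoint_counit:
  "\<beta> \<in> downsets B \<Longrightarrow> a \<in> right_adjoint A B f m \<beta> \<Longrightarrow> m \<in> D_arr B (f a) \<beta>"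
  by (simp add: right_adjoint_iff)

text \<open>
  Density in the form in which it is used. The witness is precomposed with the realizer \<open>u\<close> of
  monotonicity, so that it also works below the given element, as \<open>right_adjoint\<close> demands.
\<close>

lemma cd_transfer:
  assumes f: "f \<in> OPCA_D_cd A B"
  obtains m where "m \<in> filt B"
    and "\<forall>s \<in> filt B. \<exists>r \<in> filt A. \<forall>a \<in> carrier A. \<forall>\<gamma> \<in> downsets B.
       s \<in> D_arr B (f a) \<gamma> \<longrightarrow> value_in (app A r a) (right_adjoint A B f m \<gamma>)"
proof -
  have f': "f \<in> OPCA_D A B" using f by (simp add: OPCA_D_cd_def)
  obtain m where m: "m \<in> filt B"
    and mr: "\<forall>s \<in> filt B. \<exists>r \<in> filt A. \<forall>a \<in> carrier A. \<forall>\<gamma> \<in> downsets B.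
       s \<in> D_arr B (f a) \<gamma> \<longrightarrow> value_in (app A r a) {a' \<in> carrier A. m \<in> D_arr B (f a') \<gamma>}"
    using f unfolding OPCA_D_cd_iff by blast
  obtain u where u: "u \<in> filt B"
    and ur: "\<forall>a \<in> carrier A. \<forall>a' \<in> carrier A. a \<sqsubseteq>\<^bsub>A\<^esub> a' \<longrightarrow> u \<in> D_arr B (f a) (f a')"
    using OPCA_D_mono[OF f'] by blast
  let ?t = "App (Con m) (App (Con u) (Var 0))"
  let ?M = "B.lambda1 ?t"
  have "{a' \<in> carrier A. m \<in> D_arr B (f a') \<gamma>} \<subseteq> right_adjoint A B f ?M \<gamma>" if \<gamma>: "\<gamma> \<in> downsets B" for \<gamma>
  proof
    fix a assume "a \<in> {a' \<in> carrier A. m \<in> D_arr B (f a') \<gamma>}"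
    then have a: "a \<in> carrier A" "m \<in> D_arr B (f a) \<gamma>" by auto
    have "?M \<in> D_arr B (f a') \<gamma>" if a': "a' \<in> carrier A" "a' \<sqsubseteq>\<^bsub>A\<^esub> a" for a'
    proof (rule B.lambda1_in)
      fix \<rho> :: "nat \<Rightarrow> 'b" assume "\<rho> 0 \<in> f a'"
      moreover have "u \<in> D_arr B (f a') (f a)" using ur a a' by blast
      ultimately show "value_in (eval B \<rho> ?t) \<gamma>"
        unfolding eval.simps using a(2)
        by (intro value_in_papp[where \<alpha> = "f a"] value_in_papp[where \<alpha> = "f a'"]) simp_all
    qed (use m u \<gamma> OPCA_D_downset[OF f' a'(1)] in auto)
    then show "a \<in> right_adjoint A B f ?M \<gamma>"
      using a(1) \<gamma> by (simp add: right_adjoint_iff)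
  qed
  then have "\<forall>s \<in> filt B. \<exists>r \<in> filt A. \<forall>a \<in> carrier A. \<forall>\<gamma> \<in> downsets B.
       s \<in> D_arr B (f a) \<gamma> \<longrightarrow> value_in (app A r a) (right_adjoint A B f ?M \<gamma>)"
    using mr value_in_mono by meson
  moreover have "?M \<in> filt B" by (rule B.lambda1_filt) (use m u in simp)
  ultimately show ?thesis using that by blast
qed

text \<open>
  Each clause is obtained by writing down a suitable \<open>s\<close> and applying the transfer principle. For
  \<open>\<beta>\<close> in the separator, \<open>s\<close> is constantly an element of \<open>\<beta>\<close> in the filter, and \<open>r\<close> may be
  applied to any element of the filter. For uniform families of implications with realizer \<open>e\<close>,
  \<open>s\<close> is \<open>\<lambda>x. e (m x)\<close>. For compatibility with implication, elements \<open>a\<close> of \<open>h (\<beta> \<rightarrow> \<beta>')\<close> and \<open>a'\<close> of \<open>h \<beta>\<close> are paired to \<open>c\<close>; from an element of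
  \<open>f c\<close> one recovers elements of \<open>f a\<close> and \<open>f a'\<close> by the projections, applies \<open>m\<close> to both, and applies the
  first result to the second.
\<close>

lemma right_adjoint_in_ArrAlg:
  assumes f: "f \<in> OPCA_D A B" and m: "m \<in> filt B"
    and transfer: "\<forall>s \<in> filt B. \<exists>r \<in> filt A. \<forall>a \<in> carrier A. \<forall>\<gamma> \<in> downsets B.
       s \<in> D_arr B (f a) \<gamma> \<longrightarrow> value_in (app A r a) (right_adjoint A B f m \<gamma>)"
  shows "right_adjoint A B f m \<in> ArrAlg (D_alg B) (D_alg A)"
proof -
  interpret BA: pca_pair B A by unfold_locales
  let ?h = "right_adjoint A B f m"
  note hd = right_adjoint_downset
  have hA: "a \<in> carrier A" if "\<beta> \<in> downsets B" "a \<in> ?h \<beta>" for a \<beta>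
    using that by (simp add: right_adjoint_iff)
  note mh = right_adjoint_counit[of _ _ f m]
  obtain t where t: "t \<in> filt B"
    and tr: "\<forall>a \<in> carrier A. \<forall>a' \<in> carrier A. \<forall>c. app A a a' = Some c \<longrightarrow>
        t \<in> D_arr B (f a) (D_arr B (f a') (f c))"
    using f unfolding OPCA_D_iff by blast
  obtain u where u: "u \<in> filt B"
    and ur: "\<forall>a \<in> carrier A. \<forall>a' \<in> carrier A. a \<sqsubseteq>\<^bsub>A\<^esub> a' \<longrightarrow> u \<in> D_arr B (f a) (f a')"
    using OPCA_D_mono[OF f] by blast
  have tracker: "\<exists>x \<in> filt B. x \<in> f e" if "e \<in> filt A" for e
    using f that unfolding OPCA_D_iff D_filt_iff by blast
  obtain e0 where e0: "e0 \<in> filt B" "e0 \<in> f A.fst_comb" using tracker[OF A.fst_comb_filt] by blast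
  obtain e1 where e1: "e1 \<in> filt B" "e1 \<in> f A.snd_comb" using tracker[OF A.snd_comb_filt] by blast
  \<comment> \<open>\<open>u\<close> is needed as the projections return an element only up to the order\<close>
  let ?proj = "\<lambda>e. App (Con u) (App (App (Con t) (Con e)) (Var 0))"
  have proj: "value_in (eval B \<sigma> (?proj e)) (f a)"
    if e: "e \<in> f d" "d \<in> carrier A" and c: "c \<in> carrier A" "\<sigma> 0 \<in> f c"
      and v: "value_in (app A d c) (down A a)" and a: "a \<in> carrier A" for \<sigma> :: "nat \<Rightarrow> 'b" and e d c a
  proof -
    obtain v where v: "app A d c = Some v" "v \<in> carrier A" "v \<sqsubseteq>\<^bsub>A\<^esub> a"
      using v by (auto simp: value_in_def down_def)
    have 1: "t \<in> D_arr B (f d) (D_arr B (f c) (f v))" using tr e(2) c(1) v(1) by blast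
    have 2: "u \<in> D_arr B (f v) (f a)" using ur v a by blast
    show ?thesis
      unfolding eval.simps
      by (intro value_in_papp[where \<alpha> = "f v"] value_in_papp[where \<alpha> = "f c"]
          value_in_papp[where \<alpha> = "f d"] value_in_Some[THEN iffD2] 1 2 e(1) c(2))
  qed
  let ?t = "App (App (Con m) (?proj e0)) (App (Con m) (?proj e1))"
  let ?s = "B.lambda1 ?t"
  have t_filt: "set_pterm ?t \<subseteq> filt B" using m u t e0 e1 by simp
  obtain r where r: "r \<in> filt A"
    and rr: "\<forall>a \<in> carrier A. \<forall>\<gamma> \<in> downsets B.
       ?s \<in> D_arr B (f a) \<gamma> \<longrightarrow> value_in (app A r a) (?h \<gamma>)"
    using transfer B.lambda1_filt[OF t_filt] by blast
  let ?p = "App (Con r) A.pair_term"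
  have p_filt: "set_pterm ?p \<subseteq> filt A" using r A.set_pair_term by simp
  show ?thesis
  proof (rule BA.ArrAlgI)
    show "?h \<in> downsets B \<rightarrow>\<^sub>E downsets A"
      using hd by (auto simp: right_adjoint_def)
    show "?h \<beta> \<in> D_filt A" if \<beta>: "\<beta> \<in> D_filt B" for \<beta>
    proof -
      obtain b where b: "\<beta> \<in> downsets B" "b \<in> filt B" "b \<in> \<beta>" using \<beta> by (auto simp: D_filt_iff)
      let ?s = "B.lambda1 (Con b)"
      have "?s \<in> filt B" by (rule B.lambda1_filt) (use b in simp)
      then obtain r where r: "r \<in> filt A"
        and rr: "\<forall>a \<in> carrier A. \<forall>\<gamma> \<in> downsets B.
           ?s \<in> D_arr B (f a) \<gamma> \<longrightarrow> value_in (app A r a) (?h \<gamma>)"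
        using transfer by blast
      \<comment> \<open>the program \<open>?s\<close> ignores its argument, so \<open>r\<close> may be applied to anything, in particular to itself\<close>
      have "?s \<in> D_arr B (f r) \<beta>"
        by (rule B.lambda1_in) (use b OPCA_D_downset[OF f A.filtD[OF r]] in auto)
      then have "value_in (app A r r) (?h \<beta>)" using rr A.filtD[OF r] b(1) by blast
      then obtain v where "app A r r = Some v" "v \<in> ?h \<beta>" by (auto simp: value_in_def)
      then show ?thesis
        using A.filt_app[OF r r] hd[OF b(1)] by (auto simp: D_filt_iff)
    qed
    show "A.lambda2 ?p \<in> filt A" by (rule A.lambda2_filt[OF p_filt])
    show "A.lambda2 ?p \<in> D_arr A (?h (D_arr B \<beta> \<beta>')) (D_arr A (?h \<beta>) (?h \<beta>'))"
      if \<beta>: "\<beta> \<in> downsets B" "\<beta>' \<in> downsets B" for \<beta> \<beta>'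
    proof (rule A.lambda2_in[OF p_filt])
      have \<beta>\<beta>': "D_arr B \<beta> \<beta>' \<in> downsets B" using \<beta> by simp
      show "?h (D_arr B \<beta> \<beta>') \<in> downsets A" "?h \<beta> \<in> downsets A" "?h \<beta>' \<in> downsets A"
        using hd \<beta> \<beta>\<beta>' by auto
      fix \<rho> :: "nat \<Rightarrow> 'a"
      assume \<rho>: "\<rho> 0 \<in> ?h (D_arr B \<beta> \<beta>')" "\<rho> 1 \<in> ?h \<beta>" "range \<rho> \<subseteq> carrier A"
      obtain c where c: "c \<in> carrier A" "eval A \<rho> A.pair_term = Some c"
        and c0: "value_in (app A A.fst_comb c) (down A (\<rho> 0))"
        and c1: "value_in (app A A.snd_comb c) (down A (\<rho> 1))"
        using A.eval_pair_term[OF \<rho>(3)] by blast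
      have \<rho>c: "\<rho> 0 \<in> carrier A" "\<rho> 1 \<in> carrier A" using \<rho>(3) by auto
      have "?s \<in> D_arr B (f c) \<beta>'"
      proof (rule B.lambda1_in[OF t_filt])
        fix \<sigma> :: "nat \<Rightarrow> 'b" assume \<sigma>: "\<sigma> 0 \<in> f c"
        have 0: "value_in (eval B \<sigma> (?proj e0)) (f (\<rho> 0))"
          by (rule proj[where \<sigma> = \<sigma>, OF e0(2) A.filtD[OF A.fst_comb_filt] c(1) \<sigma> c0 \<rho>c(1)])
        have 1: "value_in (eval B \<sigma> (?proj e1)) (f (\<rho> 1))"
          by (rule proj[where \<sigma> = \<sigma>, OF e1(2) A.filtD[OF A.snd_comb_filt] c(1) \<sigma> c1 \<rho>c(2)])
        have m0: "value_in (Some m) (D_arr B (f (\<rho> 0)) (D_arr B \<beta> \<beta>'))"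
          and m1: "value_in (Some m) (D_arr B (f (\<rho> 1)) \<beta>)"
          using mh[OF \<beta>\<beta>' \<rho>(1)] mh[OF \<beta>(1) \<rho>(2)] by simp_all
        show "value_in (eval B \<sigma> ?t) \<beta>'"
          unfolding eval.simps(3)[of B \<sigma> "App (Con m) (?proj e0)"] eval.simps(3)[of B \<sigma> "Con m"] eval.simps(2)
          by (rule value_in_papp[OF value_in_papp[OF m0 0] value_in_papp[OF m1 1]])
      qed (use OPCA_D_downset[OF f c(1)] \<beta>(2) in auto)
      then show "value_in (eval A \<rho> ?p) (?h \<beta>')"
        using rr c \<beta>(2) by simp
    qed
    show "\<exists>e \<in> filt A. \<forall>(\<beta>, \<beta>') \<in> X. e \<in> D_arr A (?h \<beta>) (?h \<beta>')"
      if X: "X \<subseteq> downsets B \<times> downsets B" and ex: "\<exists>e \<in> filt B. \<forall>(\<beta>, \<beta>') \<in> X. e \<in> D_arr B \<beta> \<beta>'" for X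
    proof -
      obtain e where e: "e \<in> filt B" "\<forall>(\<beta>, \<beta>') \<in> X. e \<in> D_arr B \<beta> \<beta>'" using ex by blast
      let ?t = "App (Con e) (App (Con m) (Var 0))"
      have t_filt: "set_pterm ?t \<subseteq> filt B" using e m by simp
      obtain r where r: "r \<in> filt A"
        and rr: "\<forall>a \<in> carrier A. \<forall>\<gamma> \<in> downsets B.
           B.lambda1 ?t \<in> D_arr B (f a) \<gamma> \<longrightarrow> value_in (app A r a) (?h \<gamma>)"
        using transfer B.lambda1_filt[OF t_filt] by blast
      have "r \<in> D_arr A (?h \<beta>) (?h \<beta>')" if "(\<beta>, \<beta>') \<in> X" for \<beta> \<beta>'
        unfolding D_arr_iff
      proof (intro conjI ballI)
        have \<beta>: "\<beta> \<in> downsets B" "\<beta>' \<in> downsets B" "e \<in> D_arr B \<beta> \<beta>'" using that X e by auto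
        fix a assume a: "a \<in> ?h \<beta>"
        have ac: "a \<in> carrier A" by (rule hA[OF \<beta>(1) a])
        have "B.lambda1 ?t \<in> D_arr B (f a) \<beta>'"
        proof (rule B.lambda1_in[OF t_filt])
          fix \<sigma> :: "nat \<Rightarrow> 'b" assume "\<sigma> 0 \<in> f a"
          then show "value_in (eval B \<sigma> ?t) \<beta>'"
            unfolding eval.simps using mh[OF \<beta>(1) a] \<beta>(3)
            by (intro value_in_papp[where \<alpha> = \<beta>] value_in_papp[where \<alpha> = "f a"]) simp_all
        qed (use OPCA_D_downset[OF f ac] \<beta> in auto)
        then show "value_in (app A r a) (?h \<beta>')" using rr ac \<beta>(2) by blast
      qed (rule A.filtD[OF r])
      then show ?thesis using r by blast
    qed
  qed
qed

text \<open>
  The unit comes from the transfer principle for the identity program, which lies in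
  \<open>f a \<rightarrow> f~ \<alpha>\<close> whenever \<open>a \<in> \<alpha>\<close>.
\<close>

lemma D_tilde_in_ArrAlg_cd:
  assumes f: "f \<in> OPCA_D_cd A B"
  shows "D_tilde A f \<in> ArrAlg_cd (D_alg A) (D_alg B)"
proof -
  interpret AA: pca_pair A A by unfold_locales
  interpret BB: pca_pair B B by unfold_locales
  have f': "f \<in> OPCA_D A B" using f by (simp add: OPCA_D_cd_def)
  note d = OPCA_D_downset[OF f']
  obtain m where m: "m \<in> filt B"
    and transfer: "\<forall>s \<in> filt B. \<exists>r \<in> filt A. \<forall>a \<in> carrier A. \<forall>\<gamma> \<in> downsets B.
       s \<in> D_arr B (f a) \<gamma> \<longrightarrow> value_in (app A r a) (right_adjoint A B f m \<gamma>)"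
    using cd_transfer[OF f] by blast
  let ?h = "right_adjoint A B f m" and ?F = "D_tilde A f"
  note hd = right_adjoint_downset and Fd = D_tilde_downset[OF f']
  have maps: "ArrAlg_comp (D_alg B) ?F ?h \<in> downsets B \<rightarrow> downsets B"
    "ArrAlg_id (D_alg B) \<in> downsets B \<rightarrow> downsets B"
    "ArrAlg_comp (D_alg A) ?h ?F \<in> downsets A \<rightarrow> downsets A"
    "ArrAlg_id (D_alg A) \<in> downsets A \<rightarrow> downsets A"
    using hd Fd by (auto simp: ArrAlg_comp_def ArrAlg_id_def)
  have "m \<in> D_arr B (?F (?h \<beta>)) \<beta>" if \<beta>: "\<beta> \<in> downsets B" for \<beta>
    unfolding D_arr_iff D_tilde_app[OF hd[OF \<beta>]]
    using right_adjoint_counit[OF \<beta>, of _ f m] B.filtD[OF m] by (auto intro: value_in_app)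
  then have "ArrAlg_le (D_alg B) (D_alg B) (ArrAlg_comp (D_alg B) ?F ?h) (ArrAlg_id (D_alg B))"
    unfolding BB.ArrAlg_le_iff[OF maps(1,2)] using m by (auto simp: ArrAlg_comp_def ArrAlg_id_def)
  moreover
  have "B.lambda1 (Var 0) \<in> filt B" by (rule B.lambda1_filt) simp
  then obtain r where r: "r \<in> filt A"
    and rr: "\<forall>a \<in> carrier A. \<forall>\<gamma> \<in> downsets B.
       B.lambda1 (Var 0) \<in> D_arr B (f a) \<gamma> \<longrightarrow> value_in (app A r a) (?h \<gamma>)"
    using transfer by blast
  have "r \<in> D_arr A \<alpha> (?h (?F \<alpha>))" if \<alpha>: "\<alpha> \<in> downsets A" for \<alpha>
    unfolding D_arr_iff
  proof (intro conjI ballI)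
    fix a assume a: "a \<in> \<alpha>"
    have ac: "a \<in> carrier A" using a downsets_subset[OF \<alpha>] by blast
    have "f a \<subseteq> ?F \<alpha>" using a by (auto simp: D_tilde_app[OF \<alpha>])
    then show "value_in (app A r a) (?h (?F \<alpha>))"
      using rr ac Fd[OF \<alpha>] B.id_in[OF d[OF ac] Fd[OF \<alpha>]] by blast
  qed (rule A.filtD[OF r])
  then have "ArrAlg_le (D_alg A) (D_alg A) (ArrAlg_id (D_alg A)) (ArrAlg_comp (D_alg A) ?h ?F)"
    unfolding AA.ArrAlg_le_iff[OF maps(4,3)] using r by (auto simp: ArrAlg_comp_def ArrAlg_id_def)
  ultimately show ?thesis
    unfolding ArrAlg_cd_def
    using D_tilde_in_ArrAlg[OF f'] right_adjoint_in_ArrAlg[OF f' m transfer] by blast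
qed

section \<open>Computational density from right adjoints\<close>

definition on_principal :: "('a set \<Rightarrow> 'b set) \<Rightarrow> 'a \<Rightarrow> 'b set" where
  "on_principal F = (\<lambda>a \<in> carrier A. F (down A a))"

text \<open>
  An implicative morphism need not be monotone. It is so up to one realizer for all inclusions, because
  the identity program realizes all of them at once.
\<close>

lemma ArrAlg_mono:
  assumes F: "F \<in> ArrAlg (D_alg A) (D_alg B)"
  shows "\<exists>u \<in> filt B. \<forall>\<alpha> \<in> downsets A. \<forall>\<alpha>' \<in> downsets A. \<alpha> \<subseteq> \<alpha>' \<longrightarrow> u \<in> D_arr B (F \<alpha>) (F \<alpha>')"
proof -
  let ?X = "{(\<alpha>, \<alpha>') \<in> downsets A \<times> downsets A. \<alpha> \<subseteq> \<alpha>'}"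
  have "A.lambda1 (Var 0) \<in> filt A" by (rule A.lambda1_filt) simp
  moreover have "\<forall>(\<alpha>, \<alpha>') \<in> ?X. A.lambda1 (Var 0) \<in> D_arr A \<alpha> \<alpha>'"
    using A.id_in by auto
  moreover have "?X \<subseteq> downsets A \<times> downsets A" by auto
  ultimately have "\<exists>e \<in> filt B. \<forall>(\<alpha>, \<alpha>') \<in> ?X. e \<in> D_arr B (F \<alpha>) (F \<alpha>')"
    using F unfolding ArrAlg_iff by blast
  then show ?thesis by (elim bexE, intro bexI) auto
qed

text \<open>
  If \<open>a a' = c\<close>, then \<open>\<down>a \<subseteq> \<down>a' \<rightarrow> \<down>c\<close>; apply \<open>F\<close> and its compatibility with implication.
\<close>

lemma on_principal_in_OPCA_D:
  assumes F: "F \<in> ArrAlg (D_alg A) (D_alg B)"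
  shows "on_principal F \<in> OPCA_D A B"
proof -
  note Fd = ArrAlg_downset[OF F]
  obtain r where r: "r \<in> filt B" and rr: "\<forall>\<alpha> \<in> downsets A. \<forall>\<alpha>' \<in> downsets A.
        r \<in> D_arr B (F (D_arr A \<alpha> \<alpha>')) (D_arr B (F \<alpha>) (F \<alpha>'))"
    using F unfolding ArrAlg_iff by blast
  obtain u where u: "u \<in> filt B"
    and ur: "\<forall>\<alpha> \<in> downsets A. \<forall>\<alpha>' \<in> downsets A. \<alpha> \<subseteq> \<alpha>' \<longrightarrow> u \<in> D_arr B (F \<alpha>) (F \<alpha>')"
    using ArrAlg_mono[OF F] by blast
  have f: "on_principal F a = F (down A a)" if "a \<in> carrier A" for a
    using that by (simp add: on_principal_def)
  let ?t = "App (App (Con r) (App (Con u) (Var 0))) (Var 1)"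
  have t_filt: "set_pterm ?t \<subseteq> filt B" using r u by simp
  show ?thesis
  proof (rule OPCA_DI[OF _ _ B.lambda2_filt[OF t_filt] _ u])
    show "on_principal F \<in> carrier A \<rightarrow>\<^sub>E downsets B"
      using Fd by (auto simp: on_principal_def)
    show "on_principal F a \<in> D_filt B" if a: "a \<in> filt A" for a
    proof -
      have "down A a \<in> D_filt A"
        unfolding D_filt_iff using a A.filtD[OF a] A.down_self A.down_downset by blast
      then show ?thesis using F f[OF A.filtD[OF a]] unfolding ArrAlg_iff by simp
    qed
    show "u \<in> D_arr B (on_principal F a) (on_principal F a')"
      if "a \<in> carrier A" "a' \<in> carrier A" "a \<sqsubseteq>\<^bsub>A\<^esub> a'" for a a'
      using ur A.down_mono[OF that] that by (simp add: f)
    show "B.lambda2 ?t \<in> D_arr B (on_principal F a) (D_arr B (on_principal F a') (on_principal F c))"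
      if a: "a \<in> carrier A" "a' \<in> carrier A" and c: "app A a a' = Some c" for a a' c
    proof -
      have cc: "c \<in> carrier A" by (rule A.app_closed[OF a c])
      have dn: "down A a \<in> downsets A" "down A a' \<in> downsets A" "down A c \<in> downsets A"
        using a cc by simp_all
      have "value_in (app A a x) (down A c)" if x: "x \<in> down A a'" for x
      proof (rule A.value_in_def_le)
        have xc: "x \<in> carrier A" "x \<sqsubseteq>\<^bsub>A\<^esub> a'" using x by (auto simp: down_def)
        show "def_le A (app A a x) c"
          by (rule A.app_mono[OF a(1) a(1) xc(1) a(2) A.le_refl[OF a(1)] xc(2) c])
        show "y \<in> carrier A" if "app A a x = Some y" for y
          by (rule A.app_closed[OF a(1) xc(1) that])
      qed (use cc in auto)
      then have "a \<in> D_arr A (down A a') (down A c)" using a(1) by (simp add: D_arr_iff)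
      then have "down A a \<subseteq> D_arr A (down A a') (down A c)"
        using dn by (intro A.down_subset) simp_all
      then have 1: "u \<in> D_arr B (F (down A a)) (F (D_arr A (down A a') (down A c)))"
        using ur dn by simp
      have 2: "r \<in> D_arr B (F (D_arr A (down A a') (down A c))) (D_arr B (F (down A a')) (F (down A c)))"
        using rr dn by blast
      show ?thesis
        unfolding f[OF a(1)] f[OF a(2)] f[OF cc]
      proof (rule B.lambda2_in[OF t_filt])
        fix \<rho> :: "nat \<Rightarrow> 'b" assume \<rho>: "\<rho> 0 \<in> F (down A a)" "\<rho> 1 \<in> F (down A a')"
        show "value_in (eval B \<rho> ?t) (F (down A c))"
          unfolding eval.simps
          by (intro value_in_papp[where \<alpha> = "F (down A a')"]
              value_in_papp[where \<alpha> = "F (D_arr A (down A a') (down A c))"]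
              value_in_papp[where \<alpha> = "F (down A a)"] value_in_Some[THEN iffD2] 1 2 \<rho>)
      qed (use Fd dn in auto)
    qed
  qed
qed

lemma ArrAlg_cd_adjunction:
  assumes F: "F \<in> ArrAlg_cd (D_alg A) (D_alg B)"
  obtains h \<epsilon> \<eta> where "h \<in> ArrAlg (D_alg B) (D_alg A)" "\<epsilon> \<in> filt B" "\<eta> \<in> filt A"
    and "\<forall>\<beta> \<in> downsets B. \<epsilon> \<in> D_arr B (F (h \<beta>)) \<beta>"
    and "\<forall>\<alpha> \<in> downsets A. \<eta> \<in> D_arr A \<alpha> (h (F \<alpha>))"
proof -
  interpret AA: pca_pair A A by unfold_locales
  interpret BB: pca_pair B B by unfold_locales
  interpret BA: pca_pair B A by unfold_locales
  obtain h where h: "h \<in> ArrAlg (D_alg B) (D_alg A)"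
    and le: "ArrAlg_le (D_alg B) (D_alg B) (ArrAlg_comp (D_alg B) F h) (ArrAlg_id (D_alg B))"
     "ArrAlg_le (D_alg A) (D_alg A) (ArrAlg_id (D_alg A)) (ArrAlg_comp (D_alg A) h F)"
    and F': "F \<in> ArrAlg (D_alg A) (D_alg B)"
    using F unfolding ArrAlg_cd_def by blast
  note Fd = ArrAlg_downset[OF F'] and hd = BA.ArrAlg_downset[OF h]
  have maps: "ArrAlg_comp (D_alg B) F h \<in> downsets B \<rightarrow> downsets B"
    "ArrAlg_id (D_alg B) \<in> downsets B \<rightarrow> downsets B"
    "ArrAlg_comp (D_alg A) h F \<in> downsets A \<rightarrow> downsets A"
    "ArrAlg_id (D_alg A) \<in> downsets A \<rightarrow> downsets A"
    using hd Fd by (auto simp: ArrAlg_comp_def ArrAlg_id_def)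
  obtain \<epsilon> where "\<epsilon> \<in> filt B" "\<forall>\<beta> \<in> downsets B. \<epsilon> \<in> D_arr B (F (h \<beta>)) \<beta>"
    using le(1) unfolding BB.ArrAlg_le_iff[OF maps(1,2)] by (auto simp: ArrAlg_comp_def ArrAlg_id_def)
  moreover obtain \<eta> where "\<eta> \<in> filt A" "\<forall>\<alpha> \<in> downsets A. \<eta> \<in> D_arr A \<alpha> (h (F \<alpha>))"
    using le(2) unfolding AA.ArrAlg_le_iff[OF maps(4,3)] by (auto simp: ArrAlg_comp_def ArrAlg_id_def)
  ultimately show ?thesis using that h by blast
qed

lemma D_tilde_on_principal_le:
  assumes F: "F \<in> ArrAlg (D_alg A) (D_alg B)"
  shows "ArrAlg_le (D_alg A) (D_alg B) (D_tilde A (on_principal F)) F"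
proof -
  note f = on_principal_in_OPCA_D[OF F]
  have maps: "D_tilde A (on_principal F) \<in> downsets A \<rightarrow> downsets B" "F \<in> downsets A \<rightarrow> downsets B"
    using D_tilde_downset[OF f] ArrAlg_downset[OF F] by auto
  obtain u where u: "u \<in> filt B"
    and ur: "\<forall>\<alpha> \<in> downsets A. \<forall>\<alpha>' \<in> downsets A. \<alpha> \<subseteq> \<alpha>' \<longrightarrow> u \<in> D_arr B (F \<alpha>) (F \<alpha>')"
    using ArrAlg_mono[OF F] by blast
  have "u \<in> D_arr B (D_tilde A (on_principal F) \<alpha>) (F \<alpha>)" if \<alpha>: "\<alpha> \<in> downsets A" for \<alpha>
    unfolding D_arr_iff
  proof (intro conjI ballI)
    fix x assume "x \<in> D_tilde A (on_principal F) \<alpha>"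
    then obtain a where a: "a \<in> \<alpha>" "x \<in> on_principal F a" by (auto simp: D_tilde_app[OF \<alpha>])
    have ac: "a \<in> carrier A" using a(1) downsets_subset[OF \<alpha>] by blast
    have "u \<in> D_arr B (F (down A a)) (F \<alpha>)"
      using ur \<alpha> A.down_downset[OF ac] A.down_subset[OF a(1) \<alpha>] by blast
    moreover have "x \<in> F (down A a)" using a(2) ac by (simp add: on_principal_def)
    ultimately show "value_in (app B u x) (F \<alpha>)" by (rule value_in_app)
  qed (rule B.filtD[OF u])
  then show ?thesis unfolding ArrAlg_le_iff[OF maps] using u by blast
qed

text \<open>
  The usual proof that left adjoints preserve joins, with realizers. Write \<open>G\<close> for the morphism on the right.
  For \<open>a \<in> \<alpha>\<close>, \<open>\<down>a\<close> is mapped by the unit to \<open>h (F (\<down>a))\<close> and thus to \<open>h (G \<alpha>)\<close>; this realizes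
  \<open>\<alpha> \<rightarrow> h (G \<alpha>)\<close> uniformly in \<open>\<alpha>\<close>. Apply \<open>F\<close> and compose with the counit.
\<close>

lemma le_D_tilde_on_principal:
  assumes Fcd: "F \<in> ArrAlg_cd (D_alg A) (D_alg B)"
  shows "ArrAlg_le (D_alg A) (D_alg B) F (D_tilde A (on_principal F))"
proof -
  interpret BA: pca_pair B A by unfold_locales
  have F: "F \<in> ArrAlg (D_alg A) (D_alg B)" using Fcd by (simp add: ArrAlg_cd_def)
  obtain h \<epsilon> \<eta> where h: "h \<in> ArrAlg (D_alg B) (D_alg A)" and \<epsilon>: "\<epsilon> \<in> filt B" and \<eta>: "\<eta> \<in> filt A"
    and \<epsilon>r: "\<forall>\<beta> \<in> downsets B. \<epsilon> \<in> D_arr B (F (h \<beta>)) \<beta>"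
    and \<eta>r: "\<forall>\<alpha> \<in> downsets A. \<eta> \<in> D_arr A \<alpha> (h (F \<alpha>))"
    by (rule ArrAlg_cd_adjunction[OF Fcd])
  note Fd = ArrAlg_downset[OF F] and hd = BA.ArrAlg_downset[OF h]
  let ?G = "D_tilde A (on_principal F)"
  note Gd = D_tilde_downset[OF on_principal_in_OPCA_D[OF F]]
  have maps: "F \<in> downsets A \<rightarrow> downsets B" "?G \<in> downsets A \<rightarrow> downsets B" using Fd Gd by auto
  obtain v where v: "v \<in> filt A"
    and vr: "\<forall>\<beta> \<in> downsets B. \<forall>\<beta>' \<in> downsets B. \<beta> \<subseteq> \<beta>' \<longrightarrow> v \<in> D_arr A (h \<beta>) (h \<beta>')"
    using BA.ArrAlg_mono[OF h] by blast
  let ?t = "App (Con v) (App (Con \<eta>) (Var 0))"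
  have t_filt: "set_pterm ?t \<subseteq> filt A" using v \<eta> by simp
  have "A.lambda1 ?t \<in> D_arr A \<alpha> (h (?G \<alpha>))" if \<alpha>: "\<alpha> \<in> downsets A" for \<alpha>
  proof (rule A.lambda1_in[OF t_filt \<alpha> hd[OF Gd[OF \<alpha>]]])
    fix \<rho> :: "nat \<Rightarrow> 'a" assume \<rho>: "\<rho> 0 \<in> \<alpha>"
    have c: "\<rho> 0 \<in> carrier A" using \<rho> downsets_subset[OF \<alpha>] by blast
    have dn: "down A (\<rho> 0) \<in> downsets A" using c by simp
    have "F (down A (\<rho> 0)) \<subseteq> ?G \<alpha>"
      unfolding D_tilde_app[OF \<alpha>] using \<rho> c by (auto simp: on_principal_def intro!: bexI[of _ "\<rho> 0"])
    then have 1: "v \<in> D_arr A (h (F (down A (\<rho> 0)))) (h (?G \<alpha>))"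
      using vr Fd[OF dn] Gd[OF \<alpha>] by blast
    have 2: "\<eta> \<in> D_arr A (down A (\<rho> 0)) (h (F (down A (\<rho> 0))))" using \<eta>r dn by blast
    show "value_in (eval A \<rho> ?t) (h (?G \<alpha>))"
      unfolding eval.simps
      by (intro value_in_papp[where \<alpha> = "h (F (down A (\<rho> 0)))"] value_in_papp[where \<alpha> = "down A (\<rho> 0)"]
          value_in_Some[THEN iffD2] 1 2 A.down_self c)
  qed
  then have "\<forall>(\<alpha>, \<beta>) \<in> {(\<alpha>, h (?G \<alpha>)) | \<alpha>. \<alpha> \<in> downsets A}. A.lambda1 ?t \<in> D_arr A \<alpha> \<beta>" by auto
  moreover have "{(\<alpha>, h (?G \<alpha>)) | \<alpha>. \<alpha> \<in> downsets A} \<subseteq> downsets A \<times> downsets A"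
    using hd Gd by auto
  ultimately have "\<exists>e \<in> filt B. \<forall>(\<alpha>, \<beta>) \<in> {(\<alpha>, h (?G \<alpha>)) | \<alpha>. \<alpha> \<in> downsets A}. e \<in> D_arr B (F \<alpha>) (F \<beta>)"
    using F A.lambda1_filt[OF t_filt] unfolding ArrAlg_iff by blast
  then obtain e where e: "e \<in> filt B"
    and er: "\<forall>(\<alpha>, \<beta>) \<in> {(\<alpha>, h (?G \<alpha>)) | \<alpha>. \<alpha> \<in> downsets A}. e \<in> D_arr B (F \<alpha>) (F \<beta>)"
    by blast
  let ?s = "App (Con \<epsilon>) (App (Con e) (Var 0))"
  have s_filt: "set_pterm ?s \<subseteq> filt B" using \<epsilon> e by simp
  have "B.lambda1 ?s \<in> D_arr B (F \<alpha>) (?G \<alpha>)" if \<alpha>: "\<alpha> \<in> downsets A" for \<alpha>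
  proof (rule B.lambda1_in[OF s_filt Fd[OF \<alpha>] Gd[OF \<alpha>]])
    fix \<rho> :: "nat \<Rightarrow> 'b" assume \<rho>: "\<rho> 0 \<in> F \<alpha>"
    have 1: "e \<in> D_arr B (F \<alpha>) (F (h (?G \<alpha>)))" using er \<alpha> by blast
    have 2: "\<epsilon> \<in> D_arr B (F (h (?G \<alpha>))) (?G \<alpha>)" using \<epsilon>r Gd[OF \<alpha>] by blast
    show "value_in (eval B \<rho> ?s) (?G \<alpha>)"
      unfolding eval.simps
      by (intro value_in_papp[where \<alpha> = "F (h (?G \<alpha>))"] value_in_papp[where \<alpha> = "F \<alpha>"]
          value_in_Some[THEN iffD2] 1 2 \<rho>)
  qed
  then show ?thesis
    unfolding ArrAlg_le_iff[OF maps] using B.lambda1_filt[OF s_filt] by blast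
qed

text \<open>
  For fixed \<open>s\<close>, the pairs \<open>(\<beta>, \<gamma>)\<close> with \<open>s \<in> \<beta> \<rightarrow> \<gamma>\<close> form a family of implications with a common
  realizer, so \<open>h\<close> maps it to a family with a common realizer \<open>e\<close>. Take
  \<open>r = \<lambda>x. e (\<eta> x)\<close>, which maps \<open>a\<close> into \<open>h \<gamma>\<close>, and \<open>m = \<lambda>x. \<epsilon> (u x)\<close>, which does not depend
  on \<open>s\<close>.
\<close>

lemma on_principal_in_OPCA_D_cd:
  assumes Fcd: "F \<in> ArrAlg_cd (D_alg A) (D_alg B)"
  shows "on_principal F \<in> OPCA_D_cd A B"
proof -
  interpret BA: pca_pair B A by unfold_locales
  have F: "F \<in> ArrAlg (D_alg A) (D_alg B)" using Fcd by (simp add: ArrAlg_cd_def)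
  obtain h \<epsilon> \<eta> where h: "h \<in> ArrAlg (D_alg B) (D_alg A)" and \<epsilon>: "\<epsilon> \<in> filt B" and \<eta>: "\<eta> \<in> filt A"
    and \<epsilon>r: "\<forall>\<beta> \<in> downsets B. \<epsilon> \<in> D_arr B (F (h \<beta>)) \<beta>"
    and \<eta>r: "\<forall>\<alpha> \<in> downsets A. \<eta> \<in> D_arr A \<alpha> (h (F \<alpha>))"
    by (rule ArrAlg_cd_adjunction[OF Fcd])
  note Fd = ArrAlg_downset[OF F] and hd = BA.ArrAlg_downset[OF h]
  obtain u where u: "u \<in> filt B"
    and ur: "\<forall>\<alpha> \<in> downsets A. \<forall>\<alpha>' \<in> downsets A. \<alpha> \<subseteq> \<alpha>' \<longrightarrow> u \<in> D_arr B (F \<alpha>) (F \<alpha>')"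
    using ArrAlg_mono[OF F] by blast
  have f: "on_principal F a = F (down A a)" if "a \<in> carrier A" for a
    using that by (simp add: on_principal_def)
  let ?m = "App (Con \<epsilon>) (App (Con u) (Var 0))"
  have m_filt: "set_pterm ?m \<subseteq> filt B" using \<epsilon> u by simp
  have "\<exists>r \<in> filt A. \<forall>a \<in> carrier A. \<forall>\<gamma> \<in> downsets B.
       s \<in> D_arr B (on_principal F a) \<gamma> \<longrightarrow>
       value_in (app A r a) {a' \<in> carrier A. B.lambda1 ?m \<in> D_arr B (on_principal F a') \<gamma>}"
    if s: "s \<in> filt B" for s
  proof -
    let ?X = "{(\<beta>, \<gamma>) \<in> downsets B \<times> downsets B. s \<in> D_arr B \<beta> \<gamma>}"
    have "?X \<subseteq> downsets B \<times> downsets B" "\<forall>(\<beta>, \<gamma>) \<in> ?X. s \<in> D_arr B \<beta> \<gamma>" by auto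
    then have "\<exists>e \<in> filt A. \<forall>(\<beta>, \<gamma>) \<in> ?X. e \<in> D_arr A (h \<beta>) (h \<gamma>)"
      using h s unfolding BA.ArrAlg_iff by blast
    then obtain e where e: "e \<in> filt A" and er: "\<forall>(\<beta>, \<gamma>) \<in> ?X. e \<in> D_arr A (h \<beta>) (h \<gamma>)" by blast
    let ?r = "App (Con e) (App (Con \<eta>) (Var 0))"
    have r_filt: "set_pterm ?r \<subseteq> filt A" using e \<eta> by simp
    have "value_in (app A (A.lambda1 ?r) a) {a' \<in> carrier A. B.lambda1 ?m \<in> D_arr B (on_principal F a') \<gamma>}"
      if a: "a \<in> carrier A" and \<gamma>: "\<gamma> \<in> downsets B" and sa: "s \<in> D_arr B (on_principal F a) \<gamma>" for a \<gamma>
    proof -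
      have dn: "down A a \<in> downsets A" using a by simp
      have "A.lambda1 ?r \<in> D_arr A (down A a) (h \<gamma>)"
      proof (rule A.lambda1_in[OF r_filt dn hd[OF \<gamma>]])
        fix \<rho> :: "nat \<Rightarrow> 'a" assume \<rho>: "\<rho> 0 \<in> down A a"
        have 1: "e \<in> D_arr A (h (F (down A a))) (h \<gamma>)" using er sa \<gamma> Fd[OF dn] f[OF a] by auto
        have 2: "\<eta> \<in> D_arr A (down A a) (h (F (down A a)))" using \<eta>r dn by blast
        show "value_in (eval A \<rho> ?r) (h \<gamma>)"
          unfolding eval.simps
          by (intro value_in_papp[where \<alpha> = "h (F (down A a))"] value_in_papp[where \<alpha> = "down A a"]
              value_in_Some[THEN iffD2] 1 2 \<rho>)
      qed
      then have "value_in (app A (A.lambda1 ?r) a) (h \<gamma>)"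
        using A.down_self[OF a] by (rule value_in_app)
      moreover have "h \<gamma> \<subseteq> {a' \<in> carrier A. B.lambda1 ?m \<in> D_arr B (on_principal F a') \<gamma>}"
      proof
        fix a' assume a': "a' \<in> h \<gamma>"
        have a'c: "a' \<in> carrier A" using a' downsets_subset[OF hd[OF \<gamma>]] by blast
        have dn': "down A a' \<in> downsets A" using a'c by simp
        have "B.lambda1 ?m \<in> D_arr B (F (down A a')) \<gamma>"
        proof (rule B.lambda1_in[OF m_filt Fd[OF dn'] \<gamma>])
          fix \<rho> :: "nat \<Rightarrow> 'b" assume \<rho>: "\<rho> 0 \<in> F (down A a')"
          have 1: "u \<in> D_arr B (F (down A a')) (F (h \<gamma>))"
            using ur dn' hd[OF \<gamma>] A.down_subset[OF a' hd[OF \<gamma>]] by blast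
          have 2: "\<epsilon> \<in> D_arr B (F (h \<gamma>)) \<gamma>" using \<epsilon>r \<gamma> by blast
          show "value_in (eval B \<rho> ?m) \<gamma>"
            unfolding eval.simps
            by (intro value_in_papp[where \<alpha> = "F (h \<gamma>)"] value_in_papp[where \<alpha> = "F (down A a')"]
                value_in_Some[THEN iffD2] 1 2 \<rho>)
        qed
        then show "a' \<in> {a' \<in> carrier A. B.lambda1 ?m \<in> D_arr B (on_principal F a') \<gamma>}"
          using a'c f by simp
      qed
      ultimately show ?thesis by (rule value_in_mono)
    qed
    then show ?thesis using A.lambda1_filt[OF r_filt] by blast
  qed
  then show ?thesis
    unfolding OPCA_D_cd_iff using on_principal_in_OPCA_D[OF F] B.lambda1_filt[OF m_filt] by blast
qed

text \<open>
  As \<open>D_tilde A\<close> reflects the order, everything about the quasi-inverse \<open>on_principal\<close>, and the preorder axioms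
  on the left, follow from the isomorphism between \<open>F\<close> and \<open>D_tilde A (on_principal F)\<close> together with the
  preorder axioms on the right.
\<close>

lemma D_tilde_equivalence:
  "preorder_equivalence (OPCA_D_cd A B) (OPCA_D_le A B)
     (ArrAlg_cd (D_alg A) (D_alg B)) (ArrAlg_le (D_alg A) (D_alg B)) (D_tilde A)"
proof -
  let ?r = "OPCA_D_le A B" and ?q = "ArrAlg_le (D_alg A) (D_alg B)" and ?F = "D_tilde A"
    and ?X = "OPCA_D_cd A B" and ?Y = "ArrAlg_cd (D_alg A) (D_alg B)"
  have F: "?F f \<in> ?Y" if "f \<in> ?X" for f by (rule D_tilde_in_ArrAlg_cd[OF that])
  have G: "on_principal g \<in> ?X" if "g \<in> ?Y" for g by (rule on_principal_in_OPCA_D_cd[OF that])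
  have reflect: "?q (?F f) (?F f') \<longleftrightarrow> ?r f f'" if "f \<in> ?X" "f' \<in> ?X" for f f'
    by (rule D_tilde_le_iff) (use that in \<open>auto simp: OPCA_D_cd_def\<close>)
  have Ymap: "g \<in> downsets A \<rightarrow> downsets B" if "g \<in> ?Y" for g
    using that ArrAlg_downset by (auto simp: ArrAlg_cd_def)
  have qrefl: "?q g g" if "g \<in> ?Y" for g
    by (rule ArrAlg_le_refl[OF Ymap[OF that]])
  have qtrans: "?q g g''" if "g \<in> ?Y" "g' \<in> ?Y" "g'' \<in> ?Y" "?q g g'" "?q g' g''" for g g' g''
    by (rule ArrAlg_le_trans[OF Ymap[OF that(1)] Ymap[OF that(2)] Ymap[OF that(3)] that(4,5)])
  have FG: "?q (?F (on_principal g)) g" "?q g (?F (on_principal g))" if "g \<in> ?Y" for g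
    using D_tilde_on_principal_le le_D_tilde_on_principal[OF that] that by (auto simp: ArrAlg_cd_def)
  have Gmono: "?r (on_principal g) (on_principal g')" if g: "g \<in> ?Y" "g' \<in> ?Y" "?q g g'" for g g'
  proof -
    have "?q (?F (on_principal g)) g'"
      by (rule qtrans[OF F[OF G[OF g(1)]] g(1,2) FG(1)[OF g(1)] g(3)])
    then have "?q (?F (on_principal g)) (?F (on_principal g'))"
      by (rule qtrans[OF F[OF G[OF g(1)]] g(2) F[OF G[OF g(2)]] _ FG(2)[OF g(2)]])
    then show ?thesis using reflect G g by blast
  qed
  have GF: "?r (on_principal (?F f)) f \<and> ?r f (on_principal (?F f))" if "f \<in> ?X" for f
    using FG[OF F[OF that]] reflect[OF that G[OF F[OF that]]] reflect[OF G[OF F[OF that]] that] by blast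
  have "reflp_on ?X ?r"
    by (rule reflp_onI) (use qrefl F reflect in blast)
  moreover have "transp_on ?X ?r"
  proof (rule transp_onI)
    fix f f' f'' assume f: "f \<in> ?X" "f' \<in> ?X" "f'' \<in> ?X" "?r f f'" "?r f' f''"
    then have "?q (?F f) (?F f')" "?q (?F f') (?F f'')" using reflect by auto
    then have "?q (?F f) (?F f'')" by (rule qtrans[OF F[OF f(1)] F[OF f(2)] F[OF f(3)]])
    then show "?r f f''" using reflect f by blast
  qed
  moreover have "reflp_on ?Y ?q" by (rule reflp_onI) (rule qrefl)
  moreover have "transp_on ?Y ?q" by (rule transp_onI) (rule qtrans)
  moreover have "monotone_on ?X ?r ?q ?F" by (rule monotone_onI) (use reflect in blast)
  moreover have "monotone_on ?Y ?q ?r on_principal" by (rule monotone_onI) (rule Gmono)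
  ultimately show ?thesis
    unfolding preorder_equivalence_def using F G GF FG by blast
qed

end

theorem proposition6p16:
  fixes A :: "'a pca" and B :: "'b pca" and C :: "'c pca"
  assumes "pca A" and "pca B" and "pca C"
  shows
    "arrow_algebra (D_alg A) \<and>
     D_tilde A \<in> OPCA_D A B \<rightarrow> ArrAlg (D_alg A) (D_alg B) \<and>
     monotone_on (OPCA_D A B) (OPCA_D_le A B) (ArrAlg_le (D_alg A) (D_alg B)) (D_tilde A) \<and>
     OPCA_D_id A \<in> OPCA_D A A \<and>
     D_tilde A (OPCA_D_id A) = ArrAlg_id (D_alg A) \<and>
     (\<forall>f \<in> OPCA_D A B. \<forall>g \<in> OPCA_D B C.
        OPCA_D_comp A g f \<in> OPCA_D A C \<and>
        D_tilde A (OPCA_D_comp A g f) = ArrAlg_comp (D_alg A) (D_tilde B g) (D_tilde A f)) \<and>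
     OPCA_D_id A \<in> OPCA_D_cd A A \<and>
     (\<forall>f \<in> OPCA_D_cd A B. \<forall>g \<in> OPCA_D_cd B C. OPCA_D_comp A g f \<in> OPCA_D_cd A C) \<and>
     D_tilde A \<in> OPCA_D_cd A B \<rightarrow> ArrAlg_cd (D_alg A) (D_alg B) \<and>
     preorder_equivalence
       (OPCA_D_cd A B) (OPCA_D_le A B)
       (ArrAlg_cd (D_alg A) (D_alg B)) (ArrAlg_le (D_alg A) (D_alg B))
       (D_tilde A)"
proof -
  interpret pca_pair A B by (intro pca_pair.intro assms)
  have "monotone_on (OPCA_D A B) (OPCA_D_le A B) (ArrAlg_le (D_alg A) (D_alg B)) (D_tilde A)"
    by (rule monotone_onI) (use D_tilde_le_iff in blast)
  then show ?thesis
    by (intro conjI ballI funcsetI A.arrow_algebra_D_alg A.OPCA_D_id_closed A.OPCA_D_id_cd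
        D_tilde_id D_tilde_in_ArrAlg D_tilde_in_ArrAlg_cd D_tilde_equivalence
        OPCA_D_comp_closed[OF assms] OPCA_D_cd_comp_closed[OF assms] D_tilde_comp[OF assms(1,2)] assms)
qed

end
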